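(* Let $f:\mathbb{B}^n\to\mathbb{B}^N$ be holomorphic with $f(0)=0$. Let $\mathfrak{g}$ be the Lie algebra of the Lie group $\Gamma_f\cap\mathbf{U}(n)$, regarded as a real Lie algebra of skew-Hermitian $n\times n$ matrices. If $\mathfrak{g}$ contains a matrix $M$ such that the Hermitian matrix $L=-iM$ has $k$ positive eigenvalues (counted with multiplicity), then there is a $k$-dimensional complex linear subspace $V$ of $\mathbb{C}^n$ such that the restriction of $f$ to $V\cap\mathbb{B}^n$ is a polynomial.
   Context: $\mathbb{B}^k$ is the open unit ball in $\mathbb{C}^k$, $\mathrm{Aut}(\mathbb{B}^k)$ is its group of holomorphic automorphisms, and $\mathbf{U}(n)\subseteq \mathrm{Aut}(\mathbb{B}^n)$ is the unitary group. For holomorphic $f:\mathbb{B}^n\to\mathbb{B}^N$, $\Gamma_f=\{\gamma\in\mathrm{Aut}(\mathbb{B}^n): \exists\,\psi\in\mathrm{Aut}(\mathbb{B}^N),\ f\circ\gamma=\psi\circ f\}$; the group $\Gamma_f\cap\mathbf{U}(n)$ is a Lie group, and its Lie algebra consists of those skew-Hermitian $M$ with $e^{tM}\in\Gamma_f\cap\mathbf{U}(n)$ for all $t\in\mathbb{R}$. A (vector-valued) map is a polynomial if each of its components is. *)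

theory Defs
  imports "HOL-Analysis.Analysis" "HOL-Computational_Algebra.Polynomial"
begin

abbreviation unit_ball :: "(complex ^ 'n) set" where
  "unit_ball \<equiv> ball 0 1"

text \<open>
  Holomorphy in several variables: complex Frechet differentiability at every point.
  The derivative is taken in the full space, so the notion is meant for open \<open>S\<close>.
\<close>

definition holomorphic_map_on :: "(complex ^ 'n \<Rightarrow> complex ^ 'm) \<Rightarrow> (complex ^ 'n) set \<Rightarrow> bool" where
  "holomorphic_map_on f S \<longleftrightarrow>
     (\<forall>z\<in>S. \<exists>D. Vector_Spaces.linear (*s) (*s) D \<and> (f has_derivative D) (at z))"

text \<open>
  Automorphisms are represented by total functions; only their values on the ball matter,
  and all identities between maps of the ball are required on the ball only.
\<close>

definition Aut_ball :: "(complex ^ 'n \<Rightarrow> complex ^ 'n) set" where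
  "Aut_ball = {\<phi>. holomorphic_map_on \<phi> unit_ball \<and> \<phi> ` unit_ball \<subseteq> unit_ball \<and>
     (\<exists>\<psi>. holomorphic_map_on \<psi> unit_ball \<and> \<psi> ` unit_ball \<subseteq> unit_ball \<and>
          (\<forall>z\<in>unit_ball. \<psi> (\<phi> z) = z \<and> \<phi> (\<psi> z) = z))}"

definition Gamma_group :: "(complex ^ 'n \<Rightarrow> complex ^ 'm) \<Rightarrow> (complex ^ 'n \<Rightarrow> complex ^ 'n) set" where
  "Gamma_group f = {\<gamma>\<in>Aut_ball. \<exists>\<psi>\<in>Aut_ball. \<forall>z\<in>unit_ball. f (\<gamma> z) = \<psi> (f z)}"

definition conj_transpose :: "complex ^ 'n ^ 'n \<Rightarrow> complex ^ 'n ^ 'n" where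
  "conj_transpose A = map_matrix cnj (transpose A)"

definition unitary_matrices :: "(complex ^ 'n ^ 'n) set" where
  "unitary_matrices = {U. conj_transpose U ** U = mat 1 \<and> U ** conj_transpose U = mat 1}"

definition skew_hermitian :: "complex ^ 'n ^ 'n \<Rightarrow> bool" where
  "skew_hermitian M \<longleftrightarrow> conj_transpose M = - M"

text \<open>
  The type of square matrices is not an instance of the normed algebra classes, so \<open>exp\<close> is not
  available for it.
\<close>

definition matrix_exp :: "complex ^ 'n ^ 'n \<Rightarrow> complex ^ 'n ^ 'n" where
  "matrix_exp A = (\<Sum>k. (1 / fact k) *\<^sub>R (((**) A ^^ k) (mat 1)))"

definition Gamma_unitary :: "(complex ^ 'n \<Rightarrow> complex ^ 'm) \<Rightarrow> (complex ^ 'n ^ 'n) set" where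
  "Gamma_unitary f = {U\<in>unitary_matrices. (\<lambda>z. U *v z) \<in> Gamma_group f}"

definition Gamma_lie_algebra :: "(complex ^ 'n \<Rightarrow> complex ^ 'm) \<Rightarrow> (complex ^ 'n ^ 'n) set" where
  "Gamma_lie_algebra f =
     {M. skew_hermitian M \<and> (\<forall>t::real. matrix_exp (t *\<^sub>R M) \<in> Gamma_unitary f)}"

definition charpoly :: "complex ^ 'n ^ 'n \<Rightarrow> complex poly" where
  "charpoly A = det (mat [:0, 1:] - map_matrix (\<lambda>c. [:c:]) A)"

text \<open>The number of positive real eigenvalues, counted with algebraic multiplicity.\<close>

definition num_pos_eigenvalues :: "complex ^ 'n ^ 'n \<Rightarrow> nat" where
  "num_pos_eigenvalues A =
     (\<Sum>x \<in> {x::real. 0 < x \<and> poly (charpoly A) (complex_of_real x) = 0}.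
        order (complex_of_real x) (charpoly A))"

definition polynomial_fun :: "(complex ^ 'n \<Rightarrow> complex) \<Rightarrow> bool" where
  "polynomial_fun p \<longleftrightarrow>
     (\<exists>(A :: ('n \<Rightarrow> nat) set) c. finite A \<and>
        (\<forall>z. p z = (\<Sum>\<alpha>\<in>A. c \<alpha> * (\<Prod>i\<in>UNIV. (z $ i) ^ \<alpha> i))))"

text \<open>
  For \<open>S = V \<inter> unit_ball\<close> with a linear subspace \<open>V\<close>, polynomials in linear coordinates of \<open>V\<close> are the
  same as restrictions to \<open>V\<close> of polynomials in the ambient coordinates.
\<close>

definition polynomial_map_on :: "(complex ^ 'n \<Rightarrow> complex ^ 'm) \<Rightarrow> (complex ^ 'n) set \<Rightarrow> bool" where
  "polynomial_map_on f S \<longleftrightarrow>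
     (\<forall>j. \<exists>p. polynomial_fun p \<and> (\<forall>z\<in>S. f z $ j = p z))"

end

theory Submission
  imports Defs "HOL-Complex_Analysis.Conformal_Mappings"
begin

text \<open>
  The hermitian matrix \<open>L\<close> has an eigenbasis with real eigenvalues \<open>d\<^sub>i\<close>. In the coordinates \<open>x\<close> of
  this basis, \<open>e\<^sup>t\<^sup>M\<close> multiplies \<open>x\<^sub>i\<close> by \<open>e\<close> to the power \<open>\<i> t d\<^sub>i\<close>, and \<open>V\<close> is the span of the
  eigenvectors with \<open>d\<^sub>i > 0\<close>. Its dimension is \<open>k\<close>. Classically, \<open>f\<close> intertwines \<open>e\<^sup>t\<^sup>M\<close> with a
  one-parameter unitary group, so each component of \<open>f\<close> in an eigenbasis of the latter contains only monomials
  \<open>x\<^sup>\<alpha>\<close> with a fixed value of \<open>\<Sum>\<^sub>i \<alpha>\<^sub>i d\<^sub>i\<close>, and if all \<open>d\<^sub>i\<close> are positive there are finitely many such \<open>\<alpha>\<close>.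

  The proof below keeps this idea but avoids the unitary group on the target and power series
  in several variables; it works with the kernel \<open>cip (f z) (f w)\<close>. The automorphism \<open>\<psi>\<close> attached
  to \<open>e\<^sup>t\<^sup>M\<close> fixes the origin, so it preserves norms on the ball by the Schwarz lemma, and by polarization
  (\<open>cip_eq_of_norm_eq\<close>) the kernel is invariant under \<open>e\<^sup>t\<^sup>M\<close>. Continuing in \<open>t\<close> to the upper half plane,
  where \<open>e\<^sup>t\<^sup>M\<close> contracts \<open>V\<close>, makes the contraction \<open>E\<close> at a small imaginary time self-adjoint for
  the kernel (\<open>diag_flow_adjoint\<close>). As the target has finite dimension, this gives a matrix \<open>T\<close> with
  \<open>f (x) = T f (E x)\<close> near the origin of \<open>V\<close> (\<open>exists_intertwining_matrix\<close>).

  Such an equation bounds degrees: \<open>E\<close> multiplies the Taylor coefficient of order \<open>a\<close> in \<open>x\<^sub>i\<close> by the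
  \<open>a\<close>-th power of a number less than 1, while \<open>T\<close> is fixed, so coefficients of high order vanish
  (\<open>scaling_recursion_imp_polynomial\<close>). Thus \<open>f\<close> is a polynomial of bounded degree in each variable, hence a
  polynomial by interpolation (\<open>separately_polynomial_imp_polynomial\<close>) on a small polydisc of \<open>V\<close>. The
  identity theorem on complex lines through the origin extends this to \<open>V \<inter> unit_ball\<close>.
\<close>


section \<open>Complex vectors and the identity theorem on lines\<close>

lemma norm_vector_scale: "norm (c *s v) = cmod c * norm v"
  for v :: "complex ^ 'k"
  by (simp add: norm_vec_def norm_mult L2_set_right_distrib)

lemma scaleR_vec_eq_scale:
  fixes x :: "complex ^ 'n"
  shows "c *\<^sub>R x = of_real c *s x"
  by (simp add: vec_eq_iff) (simp add: scaleR_conv_of_real)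

text \<open>
  The form of the identity theorem used throughout: a relation known for real parameter values
  passes to complex ones.
\<close>
lemma holomorphic_zero_of_zero_near_real:
  assumes "\<phi> holomorphic_on S" "open S" "convex S" "0 \<in> S" "\<zeta> \<in> S" "\<epsilon> > 0"
    and zero: "\<And>t::real. \<bar>t\<bar> < \<epsilon> \<Longrightarrow> complex_of_real t \<in> S \<Longrightarrow> \<phi> (of_real t) = 0"
  shows "\<phi> \<zeta> = 0"
proof (rule analytic_continuation[where S = S and f = \<phi> and U = "S \<inter> of_real ` {-\<epsilon><..<\<epsilon>}" and \<xi> = 0])
  show "connected S" using assms convex_connected by blast
  show "(0::complex) islimpt S \<inter> of_real ` {-\<epsilon><..<\<epsilon>}"
    unfolding islimpt_approachable
  proof (intro allI impI)
    fix e :: real assume "e > 0"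
    obtain d where d: "d > 0" "ball 0 d \<subseteq> S"
      using \<open>open S\<close> \<open>0 \<in> S\<close> openE by blast
    define t where "t = min e (min d \<epsilon>) / 2"
    have t: "t > 0" "t < e" "t < d" "t < \<epsilon>"
      using d(1) \<open>e > 0\<close> \<open>\<epsilon> > 0\<close> by (auto simp: t_def min_def)
    then have "complex_of_real t \<in> S" using d by (intro subsetD[OF d(2)]) simp
    then show "\<exists>x'\<in>S \<inter> complex_of_real ` {- \<epsilon><..<\<epsilon>}. x' \<noteq> 0 \<and> dist x' 0 < e"
      using t by (intro bexI[of _ "of_real t"]) auto
  qed
qed (use assms in auto)

text \<open>
  The hermitian inner product. The operation \<open>inner\<close> on these vectors is only its real part, which
  does not depend holomorphically on the first argument.
\<close>
definition cip :: "complex ^ 'm \<Rightarrow> complex ^ 'm \<Rightarrow> complex" where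
  "cip v w = (\<Sum>i\<in>UNIV. v $ i * cnj (w $ i))"

lemma cip_self: "cip v v = of_real ((norm v)\<^sup>2)"
proof -
  have "(norm v)\<^sup>2 = (\<Sum>i\<in>UNIV. (cmod (v $ i))\<^sup>2)"
    by (simp add: norm_vec_def L2_set_def sum_nonneg)
  then show ?thesis
    by (simp add: cip_def flip: complex_norm_square)
qed

lemma cip_add_left: "cip (u + v) w = cip u w + cip v w"
  and cip_diff_left: "cip (u - v) w = cip u w - cip v w"
  and cip_scale_left: "cip (c *s v) w = c * cip v w"
  and cip_zero_left: "cip 0 w = 0"
  and cip_add_right: "cip w (u + v) = cip w u + cip w v"
  and cip_scale_right: "cip w (c *s v) = cnj c * cip w v"
  and cip_zero_right: "cip w 0 = 0"
  by (simp_all add: cip_def algebra_simps sum.distrib sum_subtractf sum_distrib_left)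

text \<open>
  Several-variable holomorphy enters the argument only through this chain rule along curves; no
  power series in several variables are used.
\<close>
lemma holomorphic_map_on_components:
  fixes f :: "complex ^ 'n \<Rightarrow> complex ^ 'm" and h :: "complex \<Rightarrow> complex ^ 'n"
  assumes f: "holomorphic_map_on f U" and "open S"
    and h: "\<And>i. (\<lambda>\<zeta>. h \<zeta> $ i) holomorphic_on S" and "h ` S \<subseteq> U"
  shows "(\<lambda>\<zeta>. f (h \<zeta>) $ j) holomorphic_on S"
proof (subst holomorphic_on_open[OF \<open>open S\<close>])
  show "\<forall>\<zeta>\<in>S. \<exists>c. ((\<lambda>\<zeta>. f (h \<zeta>) $ j) has_field_derivative c) (at \<zeta>)"
  proof
    fix \<zeta> assume "\<zeta> \<in> S"
    then obtain D where D: "Vector_Spaces.linear (*s) (*s) D" "(f has_derivative D) (at (h \<zeta>))"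
      using f \<open>h ` S \<subseteq> U\<close> unfolding holomorphic_map_on_def by blast
    define h' where "h' = (\<chi> i. deriv (\<lambda>\<zeta>. h \<zeta> $ i) \<zeta>)"
    have comp: "((\<lambda>\<zeta>. h \<zeta> $ i) has_derivative (\<lambda>t. (t *s h') $ i)) (at \<zeta>)" for i
      using holomorphic_derivI[OF h \<open>open S\<close> \<open>\<zeta> \<in> S\<close>, of i]
      unfolding has_field_derivative_def
      by (rule has_derivative_eq_rhs) (simp add: h'_def fun_eq_iff mult.commute)
    have "(h has_derivative (\<lambda>t. t *s h')) (at \<zeta>)"
      unfolding has_derivative_componentwise_within[of h]
    proof
      fix b :: "complex ^ 'n" assume "b \<in> Basis"
      then obtain i u where "b = axis i u" by (auto simp: Basis_vec_def)
      then show "((\<lambda>\<zeta>. inner (h \<zeta>) b) has_derivative (\<lambda>t. inner (t *s h') b)) (at \<zeta>)"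
        using has_derivative_inner_left[OF comp[of i], of u] by (simp add: inner_axis)
    qed
    from has_derivative_compose[OF this D(2)]
    have "((\<lambda>\<zeta>. f (h \<zeta>)) has_derivative (\<lambda>t. D (t *s h'))) (at \<zeta>)" .
    from bounded_linear.has_derivative[OF bounded_linear_vec_nth this, of j]
    have "((\<lambda>\<zeta>. f (h \<zeta>) $ j) has_derivative (\<lambda>t. D h' $ j * t)) (at \<zeta>)"
      by (simp add: vec.linear_scale[OF D(1)] mult.commute)
    then show "\<exists>c. ((\<lambda>\<zeta>. f (h \<zeta>) $ j) has_field_derivative c) (at \<zeta>)"
      by (auto simp: has_field_derivative_def)
  qed
qed

text \<open>
  The hermitian product is antilinear in its second argument, so a second factor that depends
  antiholomorphically on the parameter restores holomorphy.
\<close>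
lemma holomorphic_cip:
  assumes F: "\<And>i. (\<lambda>\<zeta>. F \<zeta> $ i) holomorphic_on S"
    and G: "\<And>i. (\<lambda>\<zeta>. G \<zeta> $ i) holomorphic_on cnj ` S" and "open S"
  shows "(\<lambda>\<zeta>. cip (F \<zeta>) (G (cnj \<zeta>))) holomorphic_on S"
proof -
  have "(\<lambda>\<zeta>. cnj (G (cnj \<zeta>) $ i)) holomorphic_on S" for i
    using holomorphic_on_compose_cnj_cnj[OF G \<open>open S\<close>, of i] by (simp add: o_def)
  then show ?thesis
    unfolding cip_def using F by (intro holomorphic_intros)
qed


section \<open>Automorphisms fixing the origin and polarization\<close>

text \<open>
  The one-variable Schwarz lemma, applied on the complex line through \<open>w\<close> and composed with the
  linear functional in the direction of \<open>\<psi> w\<close>.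
\<close>
lemma Schwarz_ball:
  fixes \<psi> :: "complex ^ 'n \<Rightarrow> complex ^ 'm"
  assumes \<psi>: "holomorphic_map_on \<psi> unit_ball" "\<psi> ` unit_ball \<subseteq> unit_ball" "\<psi> 0 = 0"
    and w: "w \<in> unit_ball"
  shows "norm (\<psi> w) \<le> norm w"
proof (cases "w = 0 \<or> \<psi> w = 0")
  case False
  define a where "a = norm w"
  define b where "b = norm (\<psi> w)"
  have pos: "a > 0" "b > 0" "a < 1" "b < 1" using False w \<psi>(2) by (auto simp: a_def b_def image_subset_iff)
  \<comment> \<open>The complex line through \<open>w\<close>, parametrized so that \<open>w\<close> corresponds to the real number \<open>a\<close>.\<close>
  define h where "h = (\<lambda>\<zeta>. (\<zeta> / of_real a) *s w)"
  have hB: "h ` ball 0 1 \<subseteq> unit_ball"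
    using pos by (auto simp: h_def norm_vector_scale norm_divide a_def)
  have hol: "(\<lambda>\<zeta>. cip (\<psi> (h \<zeta>)) (\<psi> w) / of_real b) holomorphic_on ball 0 1"
    unfolding cip_def using pos
    by (intro holomorphic_intros holomorphic_map_on_components[OF \<psi>(1) _ _ hB])
       (auto simp: h_def intro!: holomorphic_intros)
  have "cmod (cip (\<psi> (h \<zeta>)) (\<psi> w) / of_real b) < 1" if "cmod \<zeta> < 1" for \<zeta>
  proof -
    have "cmod (cip (\<psi> (h \<zeta>)) (\<psi> w)) \<le> (\<Sum>i\<in>UNIV. cmod (\<psi> (h \<zeta>) $ i) * cmod (\<psi> w $ i))"
      unfolding cip_def by (rule order_trans[OF norm_sum]) (simp add: norm_mult)
    also have "\<dots> \<le> norm (\<psi> (h \<zeta>)) * norm (\<psi> w)"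
      unfolding norm_vec_def
      using L2_set_mult_ineq[of "\<lambda>i. cmod (\<psi> (h \<zeta>) $ i)" "\<lambda>i. cmod (\<psi> w $ i)" UNIV] by simp
    also have "\<dots> < 1 * b"
      using that hB \<psi>(2) pos unfolding b_def
      by (intro mult_strict_right_mono) (auto simp: image_subset_iff)
    finally show ?thesis using pos by (simp add: norm_divide divide_less_eq)
  qed
  from Schwarz_Lemma(1)[OF hol _ this, of "of_real a"]
  have "cmod (cip (\<psi> (h (of_real a))) (\<psi> w) / of_real b) \<le> a"
    using pos \<psi>(3) by (simp add: h_def cip_zero_left)
  moreover have "h (of_real a) = w" using pos by (simp add: h_def)
  ultimately show ?thesis
    using pos by (simp add: cip_self norm_divide norm_power flip: b_def a_def)
       (simp add: power2_eq_square)
qed (use \<psi> in auto)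

text \<open>
  The Schwarz lemma for \<open>\<psi>\<close> and for its inverse. This replaces Cartan's theorem that such a \<open>\<psi>\<close>
  is unitary; the missing inner products are recovered by polarizing \<open>f\<close> instead of \<open>\<psi>\<close>.
\<close>
lemma Aut_ball_fixing_0_norm:
  assumes "\<psi> \<in> Aut_ball" "\<psi> 0 = 0" "w \<in> unit_ball"
  shows "norm (\<psi> w) = norm w"
proof -
  obtain \<theta> where \<psi>: "holomorphic_map_on \<psi> unit_ball" "\<psi> ` unit_ball \<subseteq> unit_ball"
    and \<theta>: "holomorphic_map_on \<theta> unit_ball" "\<theta> ` unit_ball \<subseteq> unit_ball"
      "\<forall>z\<in>unit_ball. \<theta> (\<psi> z) = z \<and> \<psi> (\<theta> z) = z"
    using assms(1) unfolding Aut_ball_def by blast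
  have "\<theta> 0 = 0" using \<theta>(3) assms(2) by (metis centre_in_ball zero_less_one)
  moreover have "\<psi> w \<in> unit_ball" using \<psi>(2) assms(3) by blast
  ultimately have "norm (\<theta> (\<psi> w)) \<le> norm (\<psi> w)"
    by (intro Schwarz_ball[OF \<theta>(1,2)])
  then show ?thesis
    using Schwarz_ball[OF \<psi> assms(2,3)] \<theta>(3) assms(3) by force
qed

text \<open>
  Polarization. The kernel \<open>cip (F z) (F w)\<close> is holomorphic in \<open>z\<close> and antiholomorphic in \<open>w\<close>,
  hence determined by its values on the diagonal. With \<open>m\<close> the midpoint of \<open>z\<close> and \<open>w\<close>, the points
  \<open>m + \<i> \<zeta> (z - w)\<close> and \<open>m + \<i> (cnj \<zeta>) (z - w)\<close> coincide for real \<open>\<zeta>\<close> and are \<open>z\<close> and \<open>w\<close> for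
  \<open>\<zeta> = - \<i>/2\<close>.
\<close>
lemma cip_eq_of_norm_eq:
  assumes F: "holomorphic_map_on F unit_ball" and G: "holomorphic_map_on G unit_ball"
    and eq: "\<And>z. z \<in> unit_ball \<Longrightarrow> norm (F z) = norm (G z)"
    and z: "z \<in> unit_ball" and w: "w \<in> unit_ball"
  shows "cip (F z) (F w) = cip (G z) (G w)"
proof -
  define m where "m = (1/2) *s (z + w)"
  define l where "l = (\<lambda>\<zeta>. m + (\<i> * \<zeta>) *s (z - w))"
  define S where "S = l -` unit_ball \<inter> (\<lambda>\<zeta>. l (cnj \<zeta>)) -` unit_ball"
  define \<phi> where "\<phi> = (\<lambda>\<zeta>. cip (F (l \<zeta>)) (F (l (cnj \<zeta>))) - cip (G (l \<zeta>)) (G (l (cnj \<zeta>))))"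
  have l_holo: "(\<lambda>\<zeta>. l \<zeta> $ i) holomorphic_on A" for i A
    by (auto simp: l_def intro!: holomorphic_intros)
  have "l = (\<lambda>\<zeta>. \<chi> i. m $ i + \<i> * \<zeta> * (z - w) $ i)"
    by (simp add: l_def fun_eq_iff vec_eq_iff algebra_simps)
  then have l_cont: "continuous_on UNIV l" "continuous_on UNIV (\<lambda>\<zeta>. l (cnj \<zeta>))"
    by (auto intro!: continuous_intros)
  have affine: "l (a *\<^sub>R x + b *\<^sub>R y) = a *\<^sub>R l x + b *\<^sub>R l y" if "a + b = 1" for a b x y
  proof -
    have "complex_of_real a + of_real b = 1" using that by (metis of_real_1 of_real_add)
    then have "m $ i = of_real a * m $ i + of_real b * m $ i" for i by (metis distrib_right mult_1)
    then show ?thesis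
      by (simp add: l_def vec_eq_iff) (simp add: scaleR_conv_of_real algebra_simps)
  qed
  have "open S"
    unfolding S_def using l_cont by (intro open_Int open_vimage) auto
  have "convex S"
    unfolding convex_def S_def
    by (auto simp: affine simp del: mem_ball mem_ball_0 intro!: convexD[OF convex_ball])
  have "cnj ` S = S"
    by (force simp: S_def image_iff intro: bexI[of _ "cnj _"])
  have m: "m \<in> unit_ball"
  proof -
    have "m = (1/2) *\<^sub>R z + (1/2) *\<^sub>R w"
      by (simp add: m_def vec_eq_iff) (simp add: scaleR_conv_of_real algebra_simps)
    then show ?thesis using z w by (auto intro!: convexD[OF convex_ball] simp del: mem_ball mem_ball_0)
  qed
  have "\<phi> holomorphic_on S"
    unfolding \<phi>_def using \<open>open S\<close> \<open>cnj ` S = S\<close> l_holo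
    by (intro holomorphic_intros holomorphic_cip holomorphic_map_on_components[OF F]
          holomorphic_map_on_components[OF G]) (auto simp: S_def)
  moreover have "0 \<in> S" using m by (simp add: S_def l_def)
  moreover have lzw: "l (-\<i>/2) = z" "l (\<i>/2) = w"
    by (auto simp: l_def m_def vec_eq_iff field_simps)
  then have "-\<i>/2 \<in> S" using z w by (simp add: S_def)
  moreover have "\<phi> (of_real t) = 0" if "of_real t \<in> S" for t
    using that eq by (simp add: \<phi>_def cip_self S_def)
  ultimately have "\<phi> (-\<i>/2) = 0"
    using \<open>open S\<close> \<open>convex S\<close>
    by (intro holomorphic_zero_of_zero_near_real[where \<phi> = \<phi> and \<zeta> = "-\<i>/2" and S = S and \<epsilon> = 1]) auto
  then show ?thesis using lzw by (simp add: \<phi>_def)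
qed


section \<open>Hermitian matrices: diagonalization, spectrum and exponential\<close>

text \<open>
  Self-adjointness for the real inner product suffices to diagonalize \<open>L\<close>, and it yields
  real eigenvalues at once.
\<close>
lemma hermitian_inner:
  assumes "conj_transpose L = L"
  shows "inner (L *v x) y = inner x (L *v y)"
proof -
  have L: "cnj (L $ i $ j) = L $ j $ i" for i j
    using assms by (simp add: conj_transpose_def map_matrix_def transpose_def vec_eq_iff)
  have re: "inner a b = Re (\<Sum>i\<in>UNIV. a $ i * cnj (b $ i))" for a b :: "complex ^ 'a"
    by (simp add: inner_vec_def inner_complex_def)
  have "inner (L *v x) y = Re (\<Sum>i\<in>UNIV. \<Sum>j\<in>UNIV. L $ i $ j * x $ j * cnj (y $ i))"
    unfolding re by (simp only: matrix_vector_mult_def vec_lambda_beta sum_distrib_right)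
  also have "(\<Sum>i\<in>UNIV. \<Sum>j\<in>UNIV. L $ i $ j * x $ j * cnj (y $ i)) =
      (\<Sum>j\<in>UNIV. x $ j * cnj ((L *v y) $ j))"
    by (subst sum.swap) (simp add: matrix_vector_mult_def L sum_distrib_left mult_ac)
  also have "Re \<dots> = inner x (L *v y)"
    by (simp only: re)
  finally show ?thesis .
qed

text \<open>
  A point where the quadratic form \<open>inner (T x) x\<close> is maximal on the unit sphere of \<open>C\<close> is an
  eigenvector: moving from \<open>x\<close> in the direction \<open>v = T x - \<mu> x\<close> would otherwise increase the
  Rayleigh quotient to first order.
\<close>
lemma self_adjoint_eigenvector_in_invariant_subspace:
  fixes T :: "'a::euclidean_space \<Rightarrow> 'a"
  assumes "linear T" and sym: "\<And>x y. inner (T x) y = inner x (T y)"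
    and C: "subspace C" "C \<noteq> {0}" and inv: "T ` C \<subseteq> C"
  shows "\<exists>x\<in>C. x \<noteq> 0 \<and> (\<exists>\<mu>. T x = \<mu> *\<^sub>R x)"
proof -
  define K where "K = C \<inter> sphere 0 1"
  have "compact K" unfolding K_def using closed_subspace[OF C(1)] by (simp add: closed_Int_compact)
  obtain y where y: "y \<in> C" "y \<noteq> 0" using C subspace_0 by blast
  have unit: "(1 / norm y) *\<^sub>R y \<in> K" if "y \<in> C" "y \<noteq> 0" for y
    using that C by (auto simp: K_def intro: subspace_scale)
  have "continuous_on K (\<lambda>x. inner (T x) x)"
    using \<open>linear T\<close> by (intro continuous_intros linear_continuous_on) (simp_all add: linear_conv_bounded_linear)
  then obtain x where x: "x \<in> K" and max: "\<And>z. z \<in> K \<Longrightarrow> inner (T z) z \<le> inner (T x) x"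
    using continuous_attains_sup[OF \<open>compact K\<close>] unit[OF y] by blast
  define \<mu> where "\<mu> = inner (T x) x"
  have max': "inner (T z) z \<le> \<mu> * inner z z" if "z \<in> C" for z
  proof (cases "z = 0")
    case False
    have "inner (T ((1 / norm z) *\<^sub>R z)) ((1 / norm z) *\<^sub>R z) \<le> \<mu>"
      using max[OF unit[OF that False]] by (simp add: \<mu>_def)
    then have "inner (T z) z / (norm z * norm z) \<le> \<mu>"
      by (simp add: linear_cmul[OF \<open>linear T\<close>])
    then show ?thesis using False by (simp add: field_simps dot_square_norm power2_eq_square)
  qed (use linear_0[OF \<open>linear T\<close>] in simp)
  have xC: "x \<in> C" and xx: "inner x x = 1" using x by (auto simp: K_def dot_square_norm)
  define v where "v = T x - \<mu> *\<^sub>R x"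
  have vC: "v \<in> C" unfolding v_def using xC inv C by (auto intro!: subspace_diff subspace_scale)
  define c where "c = inner v v"
  define e where "e = inner (T v) v - \<mu> * c"
  \<comment> \<open>The first-order term \<open>2 * t * c\<close> is controlled by the quadratic one for every \<open>t\<close>, which forces \<open>c = 0\<close>.\<close>
  have var: "2 * t * c + t\<^sup>2 * e \<le> 0" for t
  proof -
    have "inner (T (x + t *\<^sub>R v)) (x + t *\<^sub>R v) \<le> \<mu> * inner (x + t *\<^sub>R v) (x + t *\<^sub>R v)"
      using xC vC C by (intro max' subspace_add subspace_scale)
    then have "\<mu> + 2 * t * inner (T x) v + t\<^sup>2 * inner (T v) v
        \<le> \<mu> * (1 + 2 * t * inner x v + t\<^sup>2 * c)"
      using sym[of v x]
      by (simp add: linear_add[OF \<open>linear T\<close>] linear_cmul[OF \<open>linear T\<close>] inner_add_left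
          inner_add_right xx c_def power2_eq_square algebra_simps inner_commute) (simp add: \<mu>_def inner_commute)
    moreover have "inner (T x) v = c + \<mu> * inner x v"
      unfolding c_def by (subst (2) v_def) (simp add: inner_diff_left)
    ultimately show ?thesis by (simp add: e_def algebra_simps)
  qed
  have "c = 0"
  proof (rule ccontr)
    assume "c \<noteq> 0"
    then have "c > 0" by (simp add: c_def)
    define t where "t = c / (1 + \<bar>e\<bar>)"
    have "t > 0" using \<open>c > 0\<close> by (simp add: t_def)
    have "t * \<bar>e\<bar> < c" using \<open>c > 0\<close> by (simp add: t_def field_simps)
    moreover have "t * - \<bar>e\<bar> \<le> t * e" using \<open>t > 0\<close> by (intro mult_left_mono) auto
    ultimately have "2 * c + t * e > 0" using \<open>c > 0\<close> by simp
    then have "t * (2 * c + t * e) > 0" using \<open>t > 0\<close> by simp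
    then show False using var[of t] by (simp add: power2_eq_square algebra_simps)
  qed
  then have "T x = \<mu> *\<^sub>R x" by (simp add: c_def v_def)
  then show ?thesis using xC xx by (intro bexI[of _ x]) auto
qed

text \<open>
  The orthogonal complement of all eigenvectors is invariant, so a nonzero complement would contain
  a further eigenvector. Hence the eigenvectors span, and a basis chosen among them gives the
  columns of \<open>P\<close>.
\<close>
lemma hermitian_diagonalization:
  fixes L :: "complex ^ 'n ^ 'n"
  assumes "conj_transpose L = L"
  shows "\<exists>(P :: complex ^ 'n ^ 'n) Q (d :: 'n \<Rightarrow> real). P ** Q = mat 1 \<and> Q ** P = mat 1 \<and>
    (\<forall>i. L *v column i P = of_real (d i) *s column i P)"
proof -
  define E where "E = {x. \<exists>\<mu>::real. L *v x = \<mu> *\<^sub>R x}"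
  define C where "C = {y. \<forall>x\<in>E. inner x y = 0}"
  have "C = {0}"
  proof (rule ccontr)
    assume "C \<noteq> {0}"
    have "subspace C" by (auto simp: C_def subspace_def inner_add_right)
    moreover have "(*v) L ` C \<subseteq> C"
      by (auto simp: C_def E_def simp flip: hermitian_inner[OF assms])
    ultimately obtain x where "x \<in> C" "x \<noteq> 0" "x \<in> E"
      using self_adjoint_eigenvector_in_invariant_subspace[OF matrix_vector_mul_linear
          hermitian_inner[OF assms] _ \<open>C \<noteq> {0}\<close>] unfolding E_def by blast
    then show False by (auto simp: C_def)
  qed
  have "span E = UNIV"
  proof (rule ccontr)
    assume "span E \<noteq> UNIV"
    then obtain a where "a \<noteq> 0" "\<forall>x\<in>span E. inner a x = 0"
      using span_not_UNIV_orthogonal by blast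
    then have "a \<in> C" by (auto simp: C_def inner_commute span_base)
    then show False using \<open>C = {0}\<close> \<open>a \<noteq> 0\<close> by blast
  qed
  moreover have "span E \<subseteq> vec.span E"
  proof (rule span_minimal)
    show "subspace (vec.span E)"
      by (auto simp: subspace_def scaleR_vec_eq_scale intro: vec.span_add vec.span_scale vec.span_zero)
  qed (rule vec.span_superset)
  ultimately have spE: "vec.span E = UNIV" by blast
  obtain B where B: "B \<subseteq> E" "vec.independent B" "E \<subseteq> vec.span B"
    using vec.maximal_independent_subset by blast
  have spB: "vec.span B = UNIV" using B spE by (metis vec.span_mono vec.span_span top.extremum_uniqueI)
  have "card B = CARD('n)"
    using vec.basis_card_eq_dim[of B UNIV] B spB vec_dim_card[where 'a=complex and 'n='n] by auto
  then obtain u where u: "bij_betw u (UNIV :: 'n set) B"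
    using finite_same_card_bij vec.finiteI_independent[OF B(2)] by (metis finite)
  define P where "P = (\<chi> i j. u j $ i)"
  have col: "column j P = u j" for j by (simp add: column_def P_def vec_eq_iff)
  have "columns P = B" using u by (auto simp: columns_def col bij_betw_def)
  then obtain Q where Q: "P ** Q = mat 1"
    using matrix_right_invertible_span_columns[of P] spB by auto
  have "\<forall>i. \<exists>\<mu>::real. L *v u i = of_real \<mu> *s u i"
  proof
    fix i
    have "u i \<in> E" using u B(1) by (auto simp: bij_betw_def)
    then show "\<exists>\<mu>::real. L *v u i = of_real \<mu> *s u i"
      unfolding E_def by (auto simp: scaleR_vec_eq_scale)
  qed
  then obtain d where "\<And>i. L *v u i = of_real (d i) *s u i" by metis
  then show ?thesis using Q by (metis col matrix_left_right_inverse)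
qed

lemma order_prod_linear:
  fixes c :: "'i \<Rightarrow> complex"
  assumes "finite I"
  shows "order a (\<Prod>i\<in>I. [:- c i, 1:]) = card {i\<in>I. c i = a}"
  using assms
proof (induction I)
  case (insert i I)
  have "order a [:- c i, 1:] = (if c i = a then 1 else 0)"
    using order_power_n_n[of a 1] by (auto simp: order_root order_0I)
  moreover have "{j \<in> insert i I. c j = a} = (if c i = a then insert i {j\<in>I. c j = a} else {j\<in>I. c j = a})"
    by auto
  moreover have "[:- c i, 1:] * (\<Prod>i\<in>I. [:- c i, 1:]) \<noteq> 0"
    using insert by (simp only: mult_eq_0_iff prod_zero_iff) auto
  ultimately show ?case using insert by (simp add: order_mult del: mult_pCons_left)
qed (simp add: order_1_eq_0)

text \<open>
  Similarity invariance of the determinant, carried out over the ring of polynomials: the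
  constant matrix of \<open>P\<close> conjugates \<open>X - L\<close> into the diagonal matrix \<open>X - D\<close>.
\<close>
lemma charpoly_diagonalizable:
  fixes L P Q :: "complex ^ 'n ^ 'n"
  assumes PQ: "P ** Q = mat 1" "Q ** P = mat 1"
    and eig: "\<And>i. L *v column i P = c i *s column i P"
  shows "charpoly L = (\<Prod>i\<in>UNIV. [:- c i, 1:])"
proof -
  define C where "C = (map_matrix (\<lambda>c. [:c:]) :: complex ^ 'n ^ 'n \<Rightarrow> complex poly ^ 'n ^ 'n)"
  have sum_C: "[:sum g UNIV:] = (\<Sum>i\<in>UNIV. [:g i:])" for g :: "'n \<Rightarrow> complex"
  proof -
    have "[:sum g A:] = (\<Sum>i\<in>A. [:g i:])" if "finite A" for A
      using that by (induction A) (simp_all, metis add_pCons add_0)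
    then show ?thesis by simp
  qed
  have C_mult: "C (A ** B) = C A ** C B" for A B :: "complex ^ 'n ^ 'n"
    by (simp add: C_def matrix_matrix_mult_def map_matrix_def vec_eq_iff sum_C mult.commute)
  have C_1: "C (mat 1 :: complex ^ 'n ^ 'n) = mat 1"
    by (simp add: C_def mat_def map_matrix_def vec_eq_iff pCons_one)
  define D where "D = (\<chi> i j. if i = j then c i else 0)"
  have LP: "L ** P = P ** D"
  proof -
    have "(L ** P) $ i $ j = (P ** D) $ i $ j" for i j
    proof -
      have "(L ** P) $ i $ j = (L *v column j P) $ i"
        by (simp add: matrix_matrix_mult_def matrix_vector_mult_def column_def)
      also have "\<dots> = c j * P $ i $ j" unfolding eig by (simp add: column_def)
      also have "\<dots> = (P ** D) $ i $ j"
        by (simp add: matrix_matrix_mult_def D_def mult_delta_right mult.commute)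
      finally show ?thesis .
    qed
    then show ?thesis by (simp add: vec_eq_iff)
  qed
  let ?X = "mat [:0, 1:] :: complex poly ^ 'n ^ 'n"
  have comm: "?X ** A = A ** ?X" for A
    by (simp add: matrix_matrix_mult_def mat_def vec_eq_iff mult_delta_left mult_delta_right)
  have "(?X - C L) ** C P = C P ** (?X - C D)"
  proof -
    have "(?X - C L) ** C P = ?X ** C P - C L ** C P"
      by (simp add: matrix_matrix_mult_def vec_eq_iff algebra_simps sum_subtractf)
    also have "\<dots> = C P ** ?X - C P ** C D"
      by (simp add: comm LP flip: C_mult)
    also have "\<dots> = C P ** (?X - C D)"
      by (simp add: matrix_matrix_mult_def vec_eq_iff algebra_simps sum_subtractf)
    finally show ?thesis .
  qed
  then have "det (?X - C L) * det (C P) = det (C P) * det (?X - C D)"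
    by (metis det_mul)
  moreover have "det (C P) * det (C Q) = 1"
    by (metis C_1 C_mult PQ(1) det_I det_mul)
  then have "det (C P) \<noteq> 0" by auto
  ultimately have "det (?X - C L) = det (?X - C D)" by simp
  also have "\<dots> = (\<Prod>i\<in>UNIV. (?X - C D) $ i $ i)"
    by (rule det_diagonal) (simp add: C_def D_def mat_def map_matrix_def)
  also have "\<dots> = (\<Prod>i\<in>UNIV. [:- c i, 1:])"
    by (simp add: C_def D_def mat_def map_matrix_def)
  finally show ?thesis by (simp add: charpoly_def C_def)
qed

text \<open>
  Algebraic multiplicities count basis eigenvectors, because \<open>L\<close> is diagonalizable.
\<close>
lemma num_pos_eigenvalues_diagonalizable:
  fixes L P Q :: "complex ^ 'n ^ 'n"
  assumes "P ** Q = mat 1" "Q ** P = mat 1"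
    and "\<And>i. L *v column i P = of_real (d i) *s column i P"
  shows "num_pos_eigenvalues L = card {i. d i > 0}"
proof -
  have cp: "charpoly L = (\<Prod>i\<in>UNIV. [:- of_real (d i), 1:])"
    using assms by (rule charpoly_diagonalizable)
  have "{x::real. 0 < x \<and> poly (charpoly L) (of_real x) = 0} = d ` {i. d i > 0}"
    by (auto simp: cp poly_prod)
  moreover have "order (of_real x) (charpoly L) = card {i. d i = x}" for x
    by (simp add: cp order_prod_linear)
  ultimately have "num_pos_eigenvalues L = (\<Sum>x\<in>d ` {i. d i > 0}. card {i. d i = x})"
    by (simp add: num_pos_eigenvalues_def)
  also have "\<dots> = (\<Sum>x\<in>d ` {i. d i > 0}. card {i\<in>{i. d i > 0}. d i = x})"
    by (rule sum.cong[OF refl], rule arg_cong[where f = card]) auto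
  also have "\<dots> = card {i. d i > 0}"
    using sum.image_gen[of "{i. d i > 0}" "\<lambda>_. 1::nat" d] by simp
  finally show ?thesis .
qed

text \<open>
  The series defining \<open>matrix_exp\<close> converges by comparison with the exponential series of a bound
  for left multiplication by \<open>A\<close>; evaluation at \<open>u\<close> then passes inside the sum.
\<close>
lemma matrix_exp_eigenvector:
  assumes "A *v u = c *s u"
  shows "matrix_exp A *v u = exp c *s u"
proof -
  define T where "T = (\<lambda>k. (1 / fact k :: real) *\<^sub>R (((**) A ^^ k) (mat 1)))"
  have "bounded_linear ((**) A :: complex ^ 'a ^ 'a \<Rightarrow> _)"
    by (auto intro!: linear_conv_bounded_linear[THEN iffD1] linearI
        simp: matrix_add_ldistrib) (simp add: vec_eq_iff matrix_matrix_mult_def scaleR_sum_right)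
  then obtain K where K: "K > 0" "\<And>X :: complex ^ 'a ^ 'a. norm (A ** X) \<le> norm X * K"
    using bounded_linear.pos_bounded by blast
  have bd: "norm (((**) A ^^ k) (mat 1)) \<le> norm (mat 1 :: complex ^ 'a ^ 'a) * K ^ k" for k
  proof (induction k)
    case (Suc k)
    have "norm (((**) A ^^ Suc k) (mat 1)) \<le> norm (((**) A ^^ k) (mat 1)) * K"
      using K(2) by simp
    also have "\<dots> \<le> norm (mat 1 :: complex ^ 'a ^ 'a) * K ^ k * K"
      using Suc K(1) by (intro mult_right_mono) auto
    finally show ?case by (simp add: mult_ac)
  qed simp
  have "summable (\<lambda>k. norm (mat 1 :: complex ^ 'a ^ 'a) * (inverse (fact k) * K ^ k))"
    by (intro summable_mult summable_exp)
  then have "summable T"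
    by (rule summable_comparison_test[rotated])
       (auto simp: T_def divide_simps intro!: exI[of _ 0] bd)
  have bl: "bounded_linear (\<lambda>X :: complex ^ 'a ^ 'a. X *v u)"
    by (auto intro!: linear_conv_bounded_linear[THEN iffD1] linearI
        simp: matrix_vector_mult_add_rdistrib) (simp add: vec_eq_iff matrix_vector_mult_def scaleR_sum_right)
  have pow: "((**) A ^^ k) (mat 1) *v u = c ^ k *s u" for k
    by (induction k)
       (simp_all add: assms vector_smult_assoc mult_ac vector_scalar_commute flip: matrix_vector_mul_assoc)
  have Tk: "T k *v u = (c ^ k /\<^sub>R fact k) *s u" for k
  proof -
    have "T k *v u = (1 / fact k :: real) *\<^sub>R (((**) A ^^ k) (mat 1) *v u)"
      by (simp add: T_def linear_cmul[OF bounded_linear.linear[OF bl]])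
    also have "\<dots> = (c ^ k /\<^sub>R fact k) *s u"
      by (simp add: pow scaleR_vec_eq_scale) (simp add: vector_smult_assoc scaleR_conv_of_real divide_inverse)
    finally show ?thesis .
  qed
  have "bounded_linear (\<lambda>a. a *s u)"
    by (auto intro!: linear_conv_bounded_linear[THEN iffD1] linearI simp: vec_eq_iff algebra_simps)
  then have "(\<lambda>k. (c ^ k /\<^sub>R fact k) *s u) sums (exp c *s u)"
    by (rule bounded_linear.sums[OF _ exp_converges])
  moreover have "matrix_exp A *v u = (\<Sum>k. T k *v u)"
    unfolding matrix_exp_def T_def[symmetric]
    by (rule bounded_linear.suminf[OF bl \<open>summable T\<close>])
  ultimately show ?thesis by (simp add: Tk sums_iff)
qed


section \<open>Polynomial functions of several variables\<close>

text \<open>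
  Sums indexed by an arbitrary finite set, in which exponents may repeat. This makes closure under
  sums and products a matter of choosing the index set.
\<close>
lemma polynomial_fun_monomial_sum:
  fixes e :: "'s \<Rightarrow> 'n::finite \<Rightarrow> nat"
  assumes "finite S"
  shows "polynomial_fun (\<lambda>z. \<Sum>s\<in>S. c s * (\<Prod>i\<in>UNIV. (z $ i) ^ e s i))"
  unfolding polynomial_fun_def
proof (intro exI conjI allI)
  show "finite (e ` S)" using assms by simp
  fix z :: "complex ^ 'n"
  have "(\<Sum>s\<in>S. c s * (\<Prod>i\<in>UNIV. (z $ i) ^ e s i)) =
      (\<Sum>\<alpha>\<in>e ` S. \<Sum>s\<in>{s\<in>S. e s = \<alpha>}. c s * (\<Prod>i\<in>UNIV. (z $ i) ^ e s i))"
    using assms by (rule sum.image_gen)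
  also have "\<dots> = (\<Sum>\<alpha>\<in>e ` S. (\<Sum>s\<in>{s\<in>S. e s = \<alpha>}. c s) * (\<Prod>i\<in>UNIV. (z $ i) ^ \<alpha> i))"
    by (simp add: sum_distrib_right)
  finally show "(\<Sum>s\<in>S. c s * (\<Prod>i\<in>UNIV. (z $ i) ^ e s i)) =
      (\<Sum>\<alpha>\<in>e ` S. (\<Sum>s\<in>{s\<in>S. e s = \<alpha>}. c s) * (\<Prod>i\<in>UNIV. (z $ i) ^ \<alpha> i))" .
qed

lemma polynomial_funE:
  assumes "polynomial_fun p"
  obtains A a where "finite A" "p = (\<lambda>z. \<Sum>\<alpha>\<in>A. a \<alpha> * (\<Prod>i\<in>UNIV. (z $ i) ^ \<alpha> i))"
  using assms unfolding polynomial_fun_def fun_eq_iff[symmetric] by blast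

lemma polynomial_fun_const: "polynomial_fun (\<lambda>z. c)"
  using polynomial_fun_monomial_sum[of "{()}" "\<lambda>_. c" "\<lambda>_ _. 0"] by simp

lemma polynomial_fun_component: "polynomial_fun (\<lambda>z. z $ j)"
proof -
  have "(\<Prod>i\<in>UNIV. (z $ i) ^ (if i = j then 1 else 0)) = z $ j" for z :: "complex ^ 'a"
    by (subst prod.remove[of _ j]) auto
  then show ?thesis
    using polynomial_fun_monomial_sum[of "{()}" "\<lambda>_. 1" "\<lambda>_ i. if i = j then 1 else 0"] by simp
qed

lemma polynomial_fun_add:
  assumes "polynomial_fun p" "polynomial_fun q"
  shows "polynomial_fun (\<lambda>z. p z + q z)"
proof -
  obtain A a where A: "finite A" "p = (\<lambda>z. \<Sum>\<alpha>\<in>A. a \<alpha> * (\<Prod>i\<in>UNIV. (z $ i) ^ \<alpha> i))"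
    using assms(1) by (rule polynomial_funE)
  obtain B b where B: "finite B" "q = (\<lambda>z. \<Sum>\<alpha>\<in>B. b \<alpha> * (\<Prod>i\<in>UNIV. (z $ i) ^ \<alpha> i))"
    using assms(2) by (rule polynomial_funE)
  show ?thesis
    using polynomial_fun_monomial_sum[of "A <+> B" "case_sum a b" "case_sum (\<lambda>\<alpha>. \<alpha>) (\<lambda>\<alpha>. \<alpha>)"] A(1) B(1)
    by (simp add: A(2) B(2) sum.Plus)
qed

lemma polynomial_fun_mult:
  assumes "polynomial_fun p" "polynomial_fun q"
  shows "polynomial_fun (\<lambda>z. p z * q z)"
proof -
  obtain A a where A: "finite A" "p = (\<lambda>z. \<Sum>\<alpha>\<in>A. a \<alpha> * (\<Prod>i\<in>UNIV. (z $ i) ^ \<alpha> i))"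
    using assms(1) by (rule polynomial_funE)
  obtain B b where B: "finite B" "q = (\<lambda>z. \<Sum>\<alpha>\<in>B. b \<alpha> * (\<Prod>i\<in>UNIV. (z $ i) ^ \<alpha> i))"
    using assms(2) by (rule polynomial_funE)
  have "p z * q z = (\<Sum>s\<in>A \<times> B. (a (fst s) * b (snd s)) *
      (\<Prod>i\<in>UNIV. (z $ i) ^ (fst s i + snd s i)))" for z
    by (simp add: A(2) B(2) sum_product sum.cartesian_product power_add prod.distrib split_beta mult_ac)
  then show ?thesis
    using polynomial_fun_monomial_sum[of "A \<times> B" "\<lambda>s. a (fst s) * b (snd s)" "\<lambda>s i. fst s i + snd s i"] A(1) B(1)
    by simp
qed

lemma polynomial_fun_sum:
  assumes "\<And>i. i \<in> I \<Longrightarrow> polynomial_fun (p i)"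
  shows "polynomial_fun (\<lambda>z. \<Sum>i\<in>I. p i z)"
  using assms by (induction I rule: infinite_finite_induct)
    (auto intro: polynomial_fun_const polynomial_fun_add)

lemma polynomial_fun_prod:
  assumes "\<And>i. i \<in> I \<Longrightarrow> polynomial_fun (p i)"
  shows "polynomial_fun (\<lambda>z. \<Prod>i\<in>I. p i z)"
  using assms by (induction I rule: infinite_finite_induct)
    (auto intro: polynomial_fun_const polynomial_fun_mult)

lemma polynomial_fun_power:
  assumes "polynomial_fun p"
  shows "polynomial_fun (\<lambda>z. p z ^ k)"
  using assms by (induction k) (auto intro: polynomial_fun_const polynomial_fun_mult)

lemmas polynomial_fun_intros = polynomial_fun_const polynomial_fun_component polynomial_fun_add
  polynomial_fun_mult polynomial_fun_sum polynomial_fun_prod polynomial_fun_power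

lemma polynomial_fun_compose:
  assumes "polynomial_fun p" and q: "\<And>i. polynomial_fun (\<lambda>z. q z $ i)"
  shows "polynomial_fun (\<lambda>z. p (q z))"
proof -
  obtain A a where "p = (\<lambda>z. \<Sum>\<alpha>\<in>A. a \<alpha> * (\<Prod>i\<in>UNIV. (z $ i) ^ \<alpha> i))"
    using assms(1) by (rule polynomial_funE)
  then show ?thesis by (simp add: polynomial_fun_intros q)
qed

lemma polynomial_fun_poly:
  assumes "polynomial_fun q"
  shows "polynomial_fun (\<lambda>z. poly p (q z))"
  by (simp add: poly_altdef polynomial_fun_intros assms)

lemma polynomial_fun_line_holomorphic:
  assumes "polynomial_fun p"
  shows "(\<lambda>\<tau>. p (\<tau> *s z)) holomorphic_on S"
proof -
  obtain A a where "p = (\<lambda>z. \<Sum>\<alpha>\<in>A. a \<alpha> * (\<Prod>i\<in>UNIV. (z $ i) ^ \<alpha> i))"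
    using assms(1) by (rule polynomial_funE)
  then show ?thesis by (auto intro!: holomorphic_intros)
qed


section \<open>Separately polynomial functions are polynomials\<close>

text \<open>
  The weights \<open>\<Lambda> a\<close> are the Lagrange basis polynomials of the nodes.
\<close>
lemma Lagrange_interpolation:
  fixes \<xi> :: "nat \<Rightarrow> 'a::field"
  assumes inj: "inj_on \<xi> {..K}"
  obtains \<Lambda> where
    "\<And>p x. degree p \<le> K \<Longrightarrow> poly p x = (\<Sum>a\<le>K. poly (\<Lambda> a) x * poly p (\<xi> a))"
proof -
  define \<Lambda> where "\<Lambda> a = smult (inverse (\<Prod>b\<in>{..K}-{a}. \<xi> a - \<xi> b)) (\<Prod>b\<in>{..K}-{a}. [:- \<xi> b, 1:])" for a
  have deg: "degree (\<Lambda> a) \<le> K" if "a \<le> K" for a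
  proof -
    have "degree (\<Lambda> a) \<le> degree (\<Prod>b\<in>{..K}-{a}. [:- \<xi> b, 1:])"
      unfolding \<Lambda>_def by (rule degree_smult_le)
    also have "\<dots> \<le> card ({..K}-{a})"
      using degree_prod_sum_le[of "{..K}-{a}" "\<lambda>b. [:- \<xi> b, 1:]"] by simp
    also have "\<dots> = K" using that by simp
    finally show ?thesis .
  qed
  have val: "poly (\<Lambda> a) (\<xi> c) = (if a = c then 1 else 0)" if "a \<le> K" "c \<le> K" for a c
  proof (cases "a = c")
    case True
    have "(\<Prod>b\<in>{..K}-{c}. \<xi> c - \<xi> b) \<noteq> 0"
      using that inj by (auto simp: inj_on_def)
    then show ?thesis using True by (simp add: \<Lambda>_def poly_prod)
  next
    case False
    then show ?thesis using that by (auto simp: \<Lambda>_def poly_prod)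
  qed
  have "poly p x = (\<Sum>a\<le>K. poly (\<Lambda> a) x * poly p (\<xi> a))" if p: "degree p \<le> K" for p x
  proof -
    define q where "q = (\<Sum>a\<le>K. smult (poly p (\<xi> a)) (\<Lambda> a))"
    have "p = q"
    proof (rule poly_eqI_degree)
      show "poly p x = poly q x" if "x \<in> \<xi> ` {..K}" for x
        using that by (auto simp: q_def poly_sum val if_distrib cong: if_cong)
      show "degree p < card (\<xi> ` {..K})" using p by (simp add: card_image[OF inj])
      have "degree q \<le> K"
        unfolding q_def using deg by (intro degree_sum_le) (auto intro: order_trans[OF degree_smult_le])
      then show "degree q < card (\<xi> ` {..K})" by (simp add: card_image[OF inj])
    qed
    then have "poly p x = poly q x" by simp
    then show ?thesis by (simp add: q_def poly_sum mult.commute)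
  qed
  with that show ?thesis by blast
qed

text \<open>
  A polydisc in the coordinate subspace of \<open>J\<close>, as a subset of the full space.
\<close>
definition polydisc :: "'n set \<Rightarrow> real \<Rightarrow> (complex ^ 'n) set" where
  "polydisc J r = {x. (\<forall>i. i \<notin> J \<longrightarrow> x $ i = 0) \<and> (\<forall>i. norm (x $ i) < r)}"

definition vec_upd :: "'a ^ 'n \<Rightarrow> 'n \<Rightarrow> 'a \<Rightarrow> 'a ^ 'n" where
  "vec_upd x i a = (\<chi> l. if l = i then a else x $ l)"

lemma vec_upd_nth [simp]: "vec_upd x i a $ l = (if l = i then a else x $ l)"
  by (simp add: vec_upd_def)

lemma vec_upd_in_polydisc:
  "x \<in> polydisc J r \<Longrightarrow> i \<in> J \<Longrightarrow> norm \<zeta> < r \<Longrightarrow> vec_upd x i \<zeta> \<in> polydisc J r"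
  by (auto simp: polydisc_def)

text \<open>
  With a common degree bound \<open>K\<close>, Lagrange interpolation at \<open>K + 1\<close> nodes in the variable \<open>x\<^sub>i\<close>
  writes \<open>h x\<close> as a combination of values of \<open>h\<close> at points whose \<open>i\<close>-th coordinate is a node, with
  coefficients polynomial in \<open>x\<^sub>i\<close>. Repeating this over all variables reduces \<open>h\<close> to its values
  on a finite grid.
\<close>
lemma separately_polynomial_imp_polynomial:
  fixes h :: "complex ^ 'n \<Rightarrow> complex"
  assumes "r > 0"
    and sep: "\<And>i x. i \<in> J \<Longrightarrow> x \<in> polydisc J r \<Longrightarrow>
      \<exists>p. degree p \<le> K \<and> (\<forall>\<zeta>. norm \<zeta> < r \<longrightarrow> h (vec_upd x i \<zeta>) = poly p \<zeta>)"
  shows "\<exists>p. polynomial_fun p \<and> (\<forall>x\<in>polydisc J r. h x = p x)"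
proof -
  define \<xi> where "\<xi> a = complex_of_real (r * real a / real (Suc K))" for a
  have \<xi>: "norm (\<xi> a) < r" if "a \<le> K" for a
  proof -
    have "r * real a < r * real (Suc K)" using that \<open>r > 0\<close> by (intro mult_strict_left_mono) auto
    moreover have "norm (\<xi> a) = r * real a / real (Suc K)"
      unfolding \<xi>_def norm_of_real using \<open>r > 0\<close> by (intro abs_of_nonneg) auto
    ultimately show ?thesis by (simp add: divide_less_eq del: of_nat_Suc)
  qed
  have "inj_on \<xi> {..K}"
    using \<open>r > 0\<close> by (auto simp: inj_on_def \<xi>_def simp del: of_nat_Suc)
  then obtain \<Lambda> where \<Lambda>: "\<And>p x. degree p \<le> K \<Longrightarrow> poly p x = (\<Sum>a\<le>K. poly (\<Lambda> a) x * poly p (\<xi> a))"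
    using Lagrange_interpolation by blast
  have partial: "\<exists>p. polynomial_fun p \<and>
      (\<forall>x\<in>polydisc J r. (\<forall>l. l \<notin> I \<longrightarrow> x $ l = y $ l) \<longrightarrow> h x = p x)"
    if "finite I" "I \<subseteq> J" "y \<in> polydisc J r" for I y
    using that
  proof (induction I arbitrary: y)
    case empty
    have "x = y" if "\<forall>l. x $ l = y $ l" for x using that by (simp add: vec_eq_iff)
    then show ?case by (intro exI[of _ "\<lambda>_. h y"]) (auto intro: polynomial_fun_const)
  next
    case (insert i I)
    have "i \<in> J" using insert by simp
    have "\<exists>p. polynomial_fun p \<and> (\<forall>x\<in>polydisc J r.
        (\<forall>l. l \<notin> I \<longrightarrow> x $ l = vec_upd y i (\<xi> a) $ l) \<longrightarrow> h x = p x)" if "a \<le> K" for a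
      using insert \<xi>[OF that] by (intro insert.IH) (auto intro: vec_upd_in_polydisc)
    then obtain p where p: "\<And>a. a \<le> K \<Longrightarrow> polynomial_fun (p a)"
      "\<And>a x. a \<le> K \<Longrightarrow> x \<in> polydisc J r \<Longrightarrow>
        (\<forall>l. l \<notin> I \<longrightarrow> x $ l = vec_upd y i (\<xi> a) $ l) \<Longrightarrow> h x = p a x" by metis
    define P where "P x = (\<Sum>a\<le>K. poly (\<Lambda> a) (x $ i) * p a (vec_upd x i (\<xi> a)))" for x
    have upd: "polynomial_fun (\<lambda>z. vec_upd z i c $ l)" for c l
      by (cases "l = i") (auto intro: polynomial_fun_intros)
    have "polynomial_fun P" unfolding P_def
      by (intro polynomial_fun_sum polynomial_fun_mult polynomial_fun_poly polynomial_fun_component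
          polynomial_fun_compose[OF p(1)] upd) auto
    moreover have "h x = P x"
      if x: "x \<in> polydisc J r" "\<forall>l. l \<notin> insert i I \<longrightarrow> x $ l = y $ l" for x
    proof -
      obtain q where q: "degree q \<le> K" "\<And>\<zeta>. norm \<zeta> < r \<Longrightarrow> h (vec_upd x i \<zeta>) = poly q \<zeta>"
        using sep[OF \<open>i \<in> J\<close> x(1)] by blast
      have "vec_upd x i (x $ i) = x" by (simp add: vec_eq_iff)
      moreover have "norm (x $ i) < r" using x(1) by (simp add: polydisc_def)
      ultimately have "h x = poly q (x $ i)" using q(2)[of "x $ i"] by simp
      also have "\<dots> = (\<Sum>a\<le>K. poly (\<Lambda> a) (x $ i) * h (vec_upd x i (\<xi> a)))"
        by (subst \<Lambda>[OF q(1)]) (simp add: q(2) \<xi>)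
      also have "\<dots> = P x"
        unfolding P_def using x \<open>i \<in> J\<close> \<xi>
        by (intro sum.cong refl arg_cong2[where f = "(*)"] p(2)) (auto intro: vec_upd_in_polydisc)
      finally show ?thesis .
    qed
    ultimately show ?case by blast
  qed
  have "0 \<in> polydisc J r" using \<open>r > 0\<close> by (simp add: polydisc_def)
  from partial[OF _ subset_refl this] show ?thesis
    by (auto simp: polydisc_def)
qed


section \<open>Functions reproduced by a contraction\<close>

lemma higher_deriv_sum:
  fixes f :: "'i \<Rightarrow> complex \<Rightarrow> complex"
  assumes "finite I" "open S" "z \<in> S" "\<And>i. i \<in> I \<Longrightarrow> f i holomorphic_on S"
  shows "(deriv ^^ n) (\<lambda>w. \<Sum>i\<in>I. f i w) z = (\<Sum>i\<in>I. (deriv ^^ n) (f i) z)"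
  using assms(1,4)
proof (induction I)
  case (insert i I)
  have 1: "f i holomorphic_on S" using insert.prems by simp
  have 2: "(\<lambda>w. \<Sum>i\<in>I. f i w) holomorphic_on S"
      using insert.prems by (intro holomorphic_on_sum) simp
  show ?case unfolding sum.insert[OF insert.hyps] higher_deriv_add[OF 1 2 assms(2,3)]
    using insert by simp
next
  case empty
  show ?case unfolding sum.empty higher_deriv_const by simp
qed

text \<open>
  The recursion multiplies the \<open>a\<close>-th Taylor coefficients by \<open>q ^ a\<close> and by the fixed matrix \<open>T\<close>.
  The Cauchy estimates bound these coefficients uniformly in \<open>x\<close>, so iterating the recursion forces
  them to vanish once \<open>q ^ a\<close> times the size of \<open>T\<close> is below 1. Since \<open>T\<close> is the same for all \<open>x\<close>, so
  is the resulting degree bound.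
\<close>
lemma scaling_recursion_imp_polynomial:
  fixes \<phi> :: "'x \<Rightarrow> 'm::finite \<Rightarrow> complex \<Rightarrow> complex" and T :: "complex ^ 'm ^ 'm"
  assumes "r > 0" and q: "0 \<le> q" "q < 1" and "E ` X \<subseteq> X"
    and hol: "\<And>x j. x \<in> X \<Longrightarrow> \<phi> x j holomorphic_on ball 0 r"
    and bounded: "\<And>x j \<zeta>. x \<in> X \<Longrightarrow> norm \<zeta> < r \<Longrightarrow> norm (\<phi> x j \<zeta>) < 1"
    and rec: "\<And>x j \<zeta>. x \<in> X \<Longrightarrow> norm \<zeta> < r \<Longrightarrow>
      \<phi> x j \<zeta> = (\<Sum>l\<in>UNIV. T $ j $ l * \<phi> (E x) l (of_real q * \<zeta>))"
  shows "\<exists>K. \<forall>x\<in>X. \<forall>j. \<exists>p. degree p \<le> K \<and> (\<forall>\<zeta>. norm \<zeta> < r \<longrightarrow> \<phi> x j \<zeta> = poly p \<zeta>)"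
proof -
  define c where "c a x j = (deriv ^^ a) (\<phi> x j) 0" for a x j
  define \<tau> where "\<tau> = (\<Sum>j\<in>UNIV. \<Sum>l\<in>UNIV. norm (T $ j $ l))"
  have row: "(\<Sum>l\<in>UNIV. norm (T $ j $ l)) \<le> \<tau>" for j
    unfolding \<tau>_def by (rule member_le_sum[of j UNIV]) (auto intro: sum_nonneg)
  have "\<tau> \<ge> 0" by (simp add: \<tau>_def sum_nonneg)
  have qz: "norm (of_real q * \<zeta>) < r" if "norm \<zeta> < r" for \<zeta> :: complex
  proof -
    have "norm (of_real q * \<zeta>) \<le> norm \<zeta>"
      using q by (simp add: norm_mult mult_left_le_one_le)
    then show ?thesis using that by simp
  qed
  have EX: "E x \<in> X" if "x \<in> X" for x using that \<open>E ` X \<subseteq> X\<close> by blast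
  have c_rec: "c a x j = (\<Sum>l\<in>UNIV. T $ j $ l * (of_real q ^ a * c a (E x) l))" if "x \<in> X" for a x j
  proof -
    have hol': "(\<lambda>\<zeta>. \<phi> (E x) l (of_real q * \<zeta>)) holomorphic_on ball 0 r" for l
      by (rule holomorphic_on_compose_gen[OF _ hol[OF EX[OF that]], unfolded o_def])
        (auto intro!: holomorphic_intros qz)
    have "c a x j = (deriv ^^ a) (\<lambda>\<zeta>. \<Sum>l\<in>UNIV. T $ j $ l * \<phi> (E x) l (of_real q * \<zeta>)) 0"
      unfolding c_def
    proof (rule higher_deriv_transform_within_open[where S = "ball 0 r"])
      show "\<phi> x j holomorphic_on ball 0 r" by (rule hol[OF that])
      show "(\<lambda>\<zeta>. \<Sum>l\<in>UNIV. T $ j $ l * \<phi> (E x) l (of_real q * \<zeta>)) holomorphic_on ball 0 r"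
        by (intro holomorphic_intros hol')
    qed (use \<open>r > 0\<close> rec[OF that] in auto)
    also have "\<dots> = (\<Sum>l\<in>UNIV. T $ j $ l * (deriv ^^ a) (\<lambda>\<zeta>. \<phi> (E x) l (of_real q * \<zeta>)) 0)"
    proof (subst higher_deriv_sum[where S = "ball 0 r"])
      show "(\<lambda>\<zeta>. T $ j $ l * \<phi> (E x) l (of_real q * \<zeta>)) holomorphic_on ball 0 r" for l
        by (intro holomorphic_intros hol')
    qed (use \<open>r > 0\<close> in \<open>auto intro!: sum.cong higher_deriv_cmult[OF hol']\<close>)
    also have "\<dots> = (\<Sum>l\<in>UNIV. T $ j $ l * (of_real q ^ a * c a (E x) l))"
      using \<open>r > 0\<close> qz unfolding c_def
      by (subst higher_deriv_compose_linear[OF hol[OF EX[OF that]], where S = "ball 0 r"]) auto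
    finally show ?thesis .
  qed
  \<comment> \<open>The radius is halved because the Cauchy estimate needs continuity on the closed disc.\<close>
  have c_bound: "norm (c a x j) \<le> fact a / (r / 2) ^ a" if "x \<in> X" "a > 0" for a x j
  proof -
    have "norm ((deriv ^^ a) (\<phi> x j) 0) \<le> fact a * 1 / (r / 2) ^ a"
      using hol[OF that(1), of j] bounded[OF that(1)] \<open>r > 0\<close> that(2)
      by (intro Cauchy_higher_deriv_bound[where y = 0])
         (auto intro: holomorphic_on_subset intro!: holomorphic_on_imp_continuous_on[OF holomorphic_on_subset])
    then show ?thesis by (simp add: c_def)
  qed
  have c_iter: "norm (c a x j) \<le> fact a / (r / 2) ^ a * (\<tau> * q ^ a) ^ n" if "x \<in> X" "a > 0" for a x j n
    using that(1)
  proof (induction n arbitrary: x j)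
    case (Suc n)
    define M where "M = fact a / (r / 2) ^ a * (\<tau> * q ^ a) ^ n"
    have "M \<ge> 0" using \<open>\<tau> \<ge> 0\<close> q \<open>r > 0\<close> by (simp add: M_def)
    have "norm (c a x j) \<le> (\<Sum>l\<in>UNIV. norm (T $ j $ l) * (q ^ a * norm (c a (E x) l)))"
      unfolding c_rec[OF Suc.prems] using q
      by (intro order_trans[OF norm_sum]) (simp add: norm_mult norm_power)
    also have "\<dots> \<le> (\<Sum>l\<in>UNIV. norm (T $ j $ l) * (q ^ a * M))"
      using Suc.IH[OF EX[OF Suc.prems]] q unfolding M_def
      by (intro sum_mono mult_left_mono) auto
    also have "\<dots> \<le> \<tau> * (q ^ a * M)"
      using row[of j] \<open>M \<ge> 0\<close> q by (simp flip: sum_distrib_right add: mult_right_mono)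
    finally show ?case by (simp add: M_def mult_ac)
  qed (use c_bound that in simp)
  have "(\<lambda>a. \<tau> * q ^ a) \<longlonglongrightarrow> \<tau> * 0"
    using q by (intro tendsto_mult_left LIMSEQ_power_zero) simp
  then have "eventually (\<lambda>a. \<tau> * q ^ a < 1) sequentially"
    by (rule order_tendstoD) simp
  then obtain K where K: "\<And>a. a \<ge> K \<Longrightarrow> \<tau> * q ^ a < 1"
    unfolding eventually_sequentially by blast
  have c_0: "c a x j = 0" if "x \<in> X" "a > K" for a x j
  proof -
    have "(\<lambda>n. fact a / (r / 2) ^ a * (\<tau> * q ^ a) ^ n) \<longlonglongrightarrow> fact a / (r / 2) ^ a * 0"
      using K[of a] that \<open>\<tau> \<ge> 0\<close> q by (intro tendsto_mult_left LIMSEQ_power_zero) simp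
    then have "norm (c a x j) \<le> 0"
      using c_iter[OF that(1)] that(2) by (intro LIMSEQ_le_const[where X = "\<lambda>n. fact a / (r / 2) ^ a * (\<tau> * q ^ a) ^ n"]) auto
    then show ?thesis by simp
  qed
  show ?thesis
  proof (intro exI[of _ K] ballI allI)
    fix x j assume x: "x \<in> X"
    define p where "p = (\<Sum>a\<le>K. monom (c a x j / fact a) a)"
    have "degree p \<le> K"
      unfolding p_def by (intro degree_sum_le) (auto intro: order_trans[OF degree_monom_le])
    moreover have "\<phi> x j \<zeta> = poly p \<zeta>" if "norm \<zeta> < r" for \<zeta>
    proof -
      have "(\<lambda>a. c a x j / fact a * \<zeta> ^ a) sums \<phi> x j \<zeta>"
        using holomorphic_power_series[OF hol[OF x], of \<zeta> j] that by (simp add: c_def)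
      moreover have "(\<lambda>a. c a x j / fact a * \<zeta> ^ a) sums (\<Sum>a\<le>K. c a x j / fact a * \<zeta> ^ a)"
        by (intro sums_finite) (auto simp: c_0[OF x])
      ultimately show ?thesis
        using sums_unique2 by (force simp: p_def poly_sum poly_monom)
    qed
    ultimately show "\<exists>p. degree p \<le> K \<and> (\<forall>\<zeta>. norm \<zeta> < r \<longrightarrow> \<phi> x j \<zeta> = poly p \<zeta>)" by blast
  qed
qed


section \<open>Complexifying the torus action\<close>

text \<open>
  If \<open>g (U x)\<close> determines the inner products of \<open>g x\<close> with vectors spanning the range of \<open>g\<close>, and
  does so linearly, then it determines \<open>g x\<close> itself linearly. The vector \<open>v\<close> plays the role of the
  image of \<open>g w\<close> under the inverse of the adjoint of \<open>g x \<mapsto> g (U x)\<close>.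
\<close>
lemma exists_intertwining_matrix:
  fixes g :: "'x \<Rightarrow> complex ^ 'm"
  assumes W: "g ` S \<subseteq> vec.span (g ` W)"
    and adj: "\<And>w. w \<in> W \<Longrightarrow> \<exists>v. \<forall>x\<in>S. cip (g x) (g w) = cip (g (U x)) v"
  shows "\<exists>T. \<forall>x\<in>S. g x = T *v g (U x)"
proof -
  obtain B where B: "B \<subseteq> (\<lambda>x. g (U x)) ` S" "vec.independent B" "(\<lambda>x. g (U x)) ` S \<subseteq> vec.span B"
    using vec.maximal_independent_subset by blast
  then have "\<forall>b\<in>B. \<exists>x\<in>S. g (U x) = b" by blast
  then obtain \<sigma> where \<sigma>: "\<And>b. b \<in> B \<Longrightarrow> \<sigma> b \<in> S" "\<And>b. b \<in> B \<Longrightarrow> g (U (\<sigma> b)) = b"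
    by metis
  \<comment> \<open>\<open>L\<close> inverts the passage from \<open>g x\<close> to \<open>g (U x)\<close> on chosen representatives of a basis.\<close>
  obtain L where L: "Vector_Spaces.linear (*s) (*s) L" "\<And>b. b \<in> B \<Longrightarrow> L b = g (\<sigma> b)"
    using vec.linear_independent_extend[OF B(2), of "\<lambda>b. g (\<sigma> b)"] by blast
  have L_span: "L y \<in> vec.span (g ` W)" if "y \<in> vec.span B" for y
  proof -
    have "L ` B \<subseteq> vec.span (g ` W)" using L(2) \<sigma>(1) W by auto
    moreover have "L y \<in> vec.span (L ` B)"
      using that vec.linear_span_image[OF L(1)] by blast
    ultimately show ?thesis by (metis vec.span_mono vec.span_span subsetD)
  qed
  have "g x = L (g (U x))" if x: "x \<in> S" for x
  proof -
    \<comment> \<open>The error \<open>\<delta>\<close> lies in the span of \<open>g ` W\<close> and is orthogonal to it.\<close>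
    define \<delta> where "\<delta> = g x - L (g (U x))"
    have U: "g (U x) \<in> vec.span B" using B(3) x by blast
    have orth: "cip \<delta> (g w) = 0" if "w \<in> W" for w
    proof -
      obtain v where v: "\<And>x. x \<in> S \<Longrightarrow> cip (g x) (g w) = cip (g (U x)) v"
        using adj[OF \<open>w \<in> W\<close>] by blast
      have "cip (L y) (g w) = cip y v" if "y \<in> vec.span B" for y
        using that
      proof (induction rule: vec.span_induct_alt)
        case base
        show ?case by (simp add: vec.linear_0[OF L(1)] cip_zero_left)
      next
        case (step c b y)
        then show ?case using v[OF \<sigma>(1)] \<sigma>(2)
          by (simp add: vec.linear_add[OF L(1)] vec.linear_scale[OF L(1)]
              L(2) cip_add_left cip_scale_left)
      qed
      then show ?thesis using U v[OF x] by (simp add: \<delta>_def cip_diff_left)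
    qed
    have "\<delta> \<in> vec.span (g ` W)"
      unfolding \<delta>_def using W x U L_span by (intro vec.span_diff) auto
    moreover have "cip \<delta> y = 0" if "y \<in> vec.span (g ` W)" for y
      using that by (induction rule: vec.span_induct_alt)
        (auto simp: orth cip_zero_right cip_add_right cip_scale_right)
    ultimately have "cip \<delta> \<delta> = 0" by blast
    then show ?thesis by (simp add: cip_self \<delta>_def)
  qed
  then show ?thesis
    using matrix_works[OF L(1)] by (intro exI[of _ "matrix L"]) simp
qed

text \<open>
  The group generated by \<open>M\<close> in the coordinates of an eigenbasis, with complex time \<open>\<zeta>\<close>. Real times
  act by rotations; on coordinates with \<open>d i > 0\<close>, times in the upper half plane contract.
\<close>
definition diag_flow :: "('n \<Rightarrow> real) \<Rightarrow> complex \<Rightarrow> complex ^ 'n \<Rightarrow> complex ^ 'n" where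
  "diag_flow d \<zeta> x = (\<chi> i. exp (\<i> * \<zeta> * of_real (d i)) * x $ i)"

lemma diag_flow_nth: "diag_flow d \<zeta> x $ i = exp (\<i> * \<zeta> * of_real (d i)) * x $ i"
  by (simp add: diag_flow_def)

lemma norm_diag_flow_nth: "norm (diag_flow d \<zeta> x $ i) = exp (- Im \<zeta> * d i) * norm (x $ i)"
  by (simp add: diag_flow_nth norm_mult)

lemma diag_flow_add: "diag_flow d \<zeta> (diag_flow d \<eta> x) = diag_flow d (\<zeta> + \<eta>) x"
  by (simp add: vec_eq_iff diag_flow_nth algebra_simps flip: exp_add)

lemma diag_flow_0: "diag_flow d 0 x = x"
  by (simp add: vec_eq_iff diag_flow_nth)

lemma diag_flow_in_polydisc_iff:
  "diag_flow d \<zeta> x \<in> polydisc J r \<longleftrightarrow>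
    (\<forall>i. i \<notin> J \<longrightarrow> x $ i = 0) \<and> (\<forall>i. exp (- Im \<zeta> * d i) * norm (x $ i) < r)"
  by (simp add: polydisc_def norm_diag_flow_nth) (simp add: diag_flow_nth)

lemma diag_flow_in_polydisc_mono:
  assumes "\<And>i. i \<in> J \<Longrightarrow> d i > 0" and x: "diag_flow d \<zeta> x \<in> polydisc J r" and "Im \<zeta> \<le> Im \<eta>"
  shows "diag_flow d \<eta> x \<in> polydisc J r"
proof -
  have "exp (- Im \<eta> * d i) * norm (x $ i) \<le> exp (- Im \<zeta> * d i) * norm (x $ i)" for i
  proof (cases "i \<in> J")
    case True
    then show ?thesis using assms(1)[of i] \<open>Im \<zeta> \<le> Im \<eta>\<close> by (intro mult_right_mono) auto
  next
    case False
    then show ?thesis using x by (simp add: diag_flow_in_polydisc_iff)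
  qed
  then show ?thesis using x unfolding diag_flow_in_polydisc_iff by (meson le_less_trans)
qed

lemma open_diag_flow_in_polydisc: "open {\<zeta>. diag_flow d \<zeta> x \<in> polydisc J r}"
proof -
  have "open {\<zeta>. exp (- Im \<zeta> * d i) * norm (x $ i) < r}" for i
    by (intro open_Collect_less continuous_intros)
  then have "open (\<Inter>i. {\<zeta>. exp (- Im \<zeta> * d i) * norm (x $ i) < r})"
    by (intro open_INT) auto
  moreover have "{\<zeta>. diag_flow d \<zeta> x \<in> polydisc J r} =
      (if \<forall>i. i \<notin> J \<longrightarrow> x $ i = 0 then (\<Inter>i. {\<zeta>. exp (- Im \<zeta> * d i) * norm (x $ i) < r}) else {})"
    by (auto simp: diag_flow_in_polydisc_iff)
  ultimately show ?thesis by simp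
qed

text \<open>
  Invariance under real times says that the flow at time \<open>t\<close> can be moved to the other factor as
  the flow at time \<open>-t\<close>. For complex \<open>\<zeta>\<close> this continues to the time \<open>- cnj \<zeta>\<close>, because the second
  factor enters antiholomorphically. On the imaginary axis both times agree, so that the
  contractions of positive imaginary time are self-adjoint for the kernel of \<open>f\<close>.
\<close>
lemma diag_flow_adjoint:
  fixes f :: "complex ^ 'n \<Rightarrow> complex ^ 'm" and P :: "complex ^ 'n ^ 'n"
  assumes f: "holomorphic_map_on f unit_ball"
    and d: "\<And>i. i \<in> J \<Longrightarrow> d i > 0"
    and P: "\<And>x. x \<in> polydisc J r \<Longrightarrow> P *v x \<in> unit_ball"
    and inv: "\<And>t x y. x \<in> polydisc J r \<Longrightarrow> y \<in> polydisc J r \<Longrightarrow>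
      cip (f (P *v diag_flow d (of_real t) x)) (f (P *v diag_flow d (of_real t) y))
        = cip (f (P *v x)) (f (P *v y))"
    and x: "x \<in> polydisc J r" and y: "y \<in> polydisc J r" and "s \<ge> 0"
  shows "cip (f (P *v diag_flow d (\<i> * of_real s) x)) (f (P *v y))
    = cip (f (P *v x)) (f (P *v diag_flow d (\<i> * of_real s) y))"
proof -
  define S where "S = {\<zeta>. diag_flow d \<zeta> x \<in> polydisc J r} \<inter> {\<zeta>. diag_flow d \<zeta> y \<in> polydisc J r}"
  have S_up: "\<eta> \<in> S" if "\<zeta> \<in> S" "Im \<zeta> \<le> Im \<eta>" for \<zeta> \<eta>
    unfolding S_def using that
    by (auto simp: S_def intro: diag_flow_in_polydisc_mono[OF d, where \<zeta> = \<zeta> and \<eta> = \<eta>])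
  have "0 \<in> S" using x y by (simp add: S_def diag_flow_0)
  have "open S" unfolding S_def by (intro open_Int open_diag_flow_in_polydisc)
  \<comment> \<open>\<open>S\<close> is closed under increasing the imaginary part, and a convex combination has imaginary part at least the smaller of the two.\<close>
  have "convex S"
    unfolding convex_def
  proof (intro ballI allI impI)
    fix \<zeta> \<eta> and u v :: real assume *: "\<zeta> \<in> S" "\<eta> \<in> S" "0 \<le> u" "0 \<le> v" "u + v = 1"
    have "min (Im \<zeta>) (Im \<eta>) \<le> u * Im \<zeta> + v * Im \<eta>"
      using convex_bound_le[of "- Im \<zeta>" "- min (Im \<zeta>) (Im \<eta>)" "- Im \<eta>" u v] * by simp
    then show "u *\<^sub>R \<zeta> + v *\<^sub>R \<eta> \<in> S"
      using S_up[OF *(1), of "u *\<^sub>R \<zeta> + v *\<^sub>R \<eta>"] S_up[OF *(2), of "u *\<^sub>R \<zeta> + v *\<^sub>R \<eta>"] by (auto simp: min_def split: if_splits)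
  qed
  define \<phi> where "\<phi> \<zeta> = cip (f (P *v diag_flow d \<zeta> x)) (f (P *v y))
      - cip (f (P *v x)) (f (P *v diag_flow d (- cnj \<zeta>) y))" for \<zeta>
  have flow_holo: "(\<lambda>\<zeta>. (P *v diag_flow d (c * \<zeta>) z) $ i) holomorphic_on A" for c z i A
    unfolding matrix_vector_mult_def diag_flow_def by (simp, intro holomorphic_intros)
  have "\<phi> holomorphic_on S"
    unfolding \<phi>_def
  proof (intro holomorphic_on_diff holomorphic_cip[where G = "\<lambda>\<zeta>. f (P *v diag_flow d (- \<zeta>) y)"]
      holomorphic_cip[where G = "\<lambda>\<zeta>. f (P *v y)"] \<open>open S\<close> holomorphic_on_const)
    show "(\<lambda>\<zeta>. f (P *v diag_flow d \<zeta> x) $ i) holomorphic_on S" for i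
      using flow_holo[of 1] P by (intro holomorphic_map_on_components[OF f \<open>open S\<close>]) (auto simp: S_def)
    have "diag_flow d (- \<zeta>) y \<in> polydisc J r" if "\<zeta> \<in> cnj ` S" for \<zeta>
    proof -
      from that obtain \<eta> where \<eta>: "\<eta> \<in> S" "\<zeta> = cnj \<eta>" by blast
      then show ?thesis
        using diag_flow_in_polydisc_mono[OF d, where \<zeta> = \<eta> and \<eta> = "- \<zeta>" and x = y] by (auto simp: S_def)
    qed
    moreover have "open (cnj ` S)"
      unfolding image_cnj_conv_vimage_cnj using \<open>open S\<close> by (intro open_vimage) (auto intro: continuous_intros)
    ultimately show "(\<lambda>\<zeta>. f (P *v diag_flow d (- \<zeta>) y) $ i) holomorphic_on cnj ` S" for i
      using flow_holo[of "-1"] P by (intro holomorphic_map_on_components[OF f]) auto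
  qed
  moreover have "\<phi> (of_real t) = 0" for t :: real
  proof -
    have y': "diag_flow d (- of_real t) y \<in> polydisc J r"
      using y diag_flow_in_polydisc_iff[of d "- of_real t" y] by (simp add: polydisc_def)
    have "cip (f (P *v diag_flow d (of_real t) x)) (f (P *v diag_flow d (of_real t) (diag_flow d (- of_real t) y)))
        = cip (f (P *v x)) (f (P *v diag_flow d (- of_real t) y))"
      by (rule inv[OF x y'])
    then show ?thesis by (simp add: \<phi>_def diag_flow_add diag_flow_0)
  qed
  moreover have "\<i> * of_real s \<in> S" using S_up[OF \<open>0 \<in> S\<close>] \<open>s \<ge> 0\<close> by simp
  ultimately have "\<phi> (\<i> * of_real s) = 0"
    using \<open>open S\<close> \<open>convex S\<close> \<open>0 \<in> S\<close>
    by (intro holomorphic_zero_of_zero_near_real[where \<phi> = \<phi> and \<zeta> = "\<i> * of_real s" and S = S and \<epsilon> = 1]) auto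
  then show ?thesis by (simp add: \<phi>_def)
qed

text \<open>
  A basis of the span of the range of \<open>f \<circ> P\<close> consists of finitely many values, at points of the
  polydisc. A sufficiently short time \<open>s\<close> allows all of these points to be moved backwards, by the
  expanding flow of time \<open>- \<i> s\<close>, without leaving the polydisc. Self-adjointness then expresses \<open>f (P x)\<close>
  through \<open>f (P (E x))\<close> by one matrix, where \<open>E\<close> contracts every coordinate in \<open>J\<close> by a fixed factor.
\<close>
lemma polynomial_on_polydisc:
  fixes f :: "complex ^ 'n \<Rightarrow> complex ^ 'm" and P :: "complex ^ 'n ^ 'n"
  assumes f: "holomorphic_map_on f unit_ball" "f ` unit_ball \<subseteq> unit_ball"
    and d: "\<And>i. i \<in> J \<Longrightarrow> d i > 0" and "r > 0"
    and P: "\<And>x. x \<in> polydisc J r \<Longrightarrow> P *v x \<in> unit_ball"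
    and inv: "\<And>t x y. x \<in> polydisc J r \<Longrightarrow> y \<in> polydisc J r \<Longrightarrow>
      cip (f (P *v diag_flow d (of_real t) x)) (f (P *v diag_flow d (of_real t) y))
        = cip (f (P *v x)) (f (P *v y))"
  shows "\<exists>p. polynomial_fun p \<and> (\<forall>x\<in>polydisc J r. f (P *v x) $ j = p x)"
proof -
  define g where "g x = f (P *v x)" for x
  define X where "X = polydisc J r"
  obtain B where B: "B \<subseteq> g ` X" "vec.independent B" "g ` X \<subseteq> vec.span B"
    using vec.maximal_independent_subset by blast
  then obtain W where W: "W \<subseteq> X" "finite W" "B = g ` W"
    using finite_subset_image[OF vec.finiteI_independent[OF B(2)] B(1)] by blast
  have "eventually (\<lambda>s. diag_flow d (- \<i> * of_real s) w \<in> X) (at_right 0)" if "w \<in> X" for w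
  proof -
    have "open ((\<lambda>s. - \<i> * complex_of_real s) -` {\<zeta>. diag_flow d \<zeta> w \<in> X})"
      unfolding X_def by (intro open_vimage open_diag_flow_in_polydisc continuous_intros)
    moreover have "0 \<in> (\<lambda>s. - \<i> * complex_of_real s) -` {\<zeta>. diag_flow d \<zeta> w \<in> X}"
      using that by (simp add: diag_flow_0)
    ultimately have "eventually (\<lambda>s. s \<in> (\<lambda>s. - \<i> * complex_of_real s) -` {\<zeta>. diag_flow d \<zeta> w \<in> X}) (at 0)"
      by (intro eventually_at_in_open')
    then show ?thesis by (simp add: eventually_at_split)
  qed
  then have "eventually (\<lambda>s. \<forall>w\<in>W. diag_flow d (- \<i> * of_real s) w \<in> X) (at_right (0::real))"
    using W by (intro eventually_ball_finite) auto
  then have "eventually (\<lambda>s. s > 0 \<and> (\<forall>w\<in>W. diag_flow d (- \<i> * of_real s) w \<in> X)) (at_right (0::real))"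
    using eventually_at_right_less by (rule eventually_conj[rotated])
  then obtain s where s: "s > 0" "\<And>w. w \<in> W \<Longrightarrow> diag_flow d (- \<i> * of_real s) w \<in> X"
    using eventually_happens'[OF trivial_limit_at_right_real] by blast
  define E where "E = diag_flow d (\<i> * of_real s)"
  have "E ` X \<subseteq> X"
    using diag_flow_in_polydisc_mono[OF d, where \<zeta> = 0 and \<eta> = "\<i> * of_real s"] s(1)
    by (auto simp: E_def X_def diag_flow_0)
  have "\<exists>T. \<forall>x\<in>X. g x = T *v g (E x)"
  proof (rule exists_intertwining_matrix[where g = g and S = X and W = W and U = E])
    show "g ` X \<subseteq> vec.span (g ` W)" using B W by auto
    fix w assume "w \<in> W"
    define w' where "w' = diag_flow d (- \<i> * of_real s) w"
    have "E w' = w" by (simp add: E_def w'_def diag_flow_add diag_flow_0)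
    moreover have "w' \<in> X" using s(2)[OF \<open>w \<in> W\<close>] by (simp add: w'_def)
    ultimately have "cip (g x) (g w) = cip (g (E x)) (g w')" if "x \<in> X" for x
      using diag_flow_adjoint[where f = f and P = P and J = J and r = r and d = d and x = x and y = w' and s = s,
          OF f(1) d P inv] that s(1)
      unfolding g_def X_def E_def by simp
    then show "\<exists>v. \<forall>x\<in>X. cip (g x) (g w) = cip (g (E x)) v" by blast
  qed
  then obtain T where T: "\<And>x. x \<in> X \<Longrightarrow> g x = T *v g (E x)" by blast
  have upd_holo: "(\<lambda>\<zeta>. (P *v vec_upd x i \<zeta>) $ l) holomorphic_on A" for x i l A
    unfolding matrix_vector_mult_def
    by (simp, intro holomorphic_intros) (case_tac "j = i"; simp)
  have "\<exists>K. \<forall>x\<in>X. \<forall>j. \<exists>p. degree p \<le> K \<and> (\<forall>\<zeta>. norm \<zeta> < r \<longrightarrow> g (vec_upd x i \<zeta>) $ j = poly p \<zeta>)"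
    if i: "i \<in> J" for i
  proof -
    have upd: "vec_upd x i \<zeta> \<in> X" if "x \<in> X" "norm \<zeta> < r" for x \<zeta>
      using that i vec_upd_in_polydisc by (auto simp: X_def)
    have E_upd: "E (vec_upd x i \<zeta>) = vec_upd (E x) i (of_real (exp (- s * d i)) * \<zeta>)" for x \<zeta>
      by (simp add: E_def vec_eq_iff diag_flow_nth flip: exp_of_real)
    show ?thesis
    proof (rule scaling_recursion_imp_polynomial[where \<phi> = "\<lambda>x j \<zeta>. g (vec_upd x i \<zeta>) $ j" and r = r
          and E = E and X = X and T = T and q = "exp (- s * d i)"])
      show "exp (- s * d i) < 1" using s(1) d[OF i] by simp
      show "(\<lambda>\<zeta>. g (vec_upd x i \<zeta>) $ j) holomorphic_on ball 0 r" if "x \<in> X" for x j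
        unfolding g_def using upd[OF that] P
        by (intro holomorphic_map_on_components[OF f(1)] upd_holo) (auto simp: X_def)
      show "norm (g (vec_upd x i \<zeta>) $ j) < 1" if "x \<in> X" "norm \<zeta> < r" for x j \<zeta>
      proof -
        have "norm (g (vec_upd x i \<zeta>)) < 1"
          using f(2) P upd[OF that] by (auto simp: g_def X_def image_subset_iff)
        then show ?thesis using Finite_Cartesian_Product.norm_nth_le le_less_trans by blast
      qed
      show "g (vec_upd x i \<zeta>) $ j = (\<Sum>l\<in>UNIV. T $ j $ l * g (vec_upd (E x) i (of_real (exp (- s * d i)) * \<zeta>)) $ l)"
        if "x \<in> X" "norm \<zeta> < r" for x j \<zeta>
        using T[OF upd[OF that]] by (simp add: E_upd matrix_vector_mult_def)
    qed (use \<open>r > 0\<close> \<open>E ` X \<subseteq> X\<close> in auto)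
  qed
  then obtain K where K: "\<And>i x j. i \<in> J \<Longrightarrow> x \<in> X \<Longrightarrow>
      \<exists>p. degree p \<le> K i \<and> (\<forall>\<zeta>. norm \<zeta> < r \<longrightarrow> g (vec_upd x i \<zeta>) $ j = poly p \<zeta>)"
    by metis
  have "K i \<le> (\<Sum>i\<in>UNIV. K i)" for i by (rule member_le_sum) auto
  then have "\<exists>p. degree p \<le> (\<Sum>i\<in>UNIV. K i) \<and> (\<forall>\<zeta>. norm \<zeta> < r \<longrightarrow> g (vec_upd x i \<zeta>) $ j = poly p \<zeta>)"
    if "i \<in> J" "x \<in> X" for i x
    using K[OF that, of j] order_trans by blast
  then show ?thesis
    using separately_polynomial_imp_polynomial[OF \<open>r > 0\<close>, of J "\<Sum>i\<in>UNIV. K i" "\<lambda>x. g x $ j"]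
    by (simp add: X_def g_def)
qed


section \<open>From the polydisc to the subspace, and the theorem\<close>

text \<open>
  Small multiples of \<open>z\<close> are where the polynomial formula is already known; the identity theorem
  on the complex line through \<open>z\<close> carries it to \<open>z\<close> itself.
\<close>
lemma polynomial_on_ball_of_polydisc:
  fixes f :: "complex ^ 'n \<Rightarrow> complex ^ 'm"
  assumes f: "holomorphic_map_on f unit_ball" and p: "polynomial_fun p"
    and z: "z \<in> unit_ball"
    and "\<epsilon> > 0" and eq: "\<And>t::real. \<bar>t\<bar> < \<epsilon> \<Longrightarrow> f (of_real t *s z) $ j = p (of_real t *s z)"
  shows "f z $ j = p z"
proof -
  \<comment> \<open>A radius strictly between 1 and the one at which the line through \<open>z\<close> leaves the ball.\<close>
  define R where "R = 2 / (1 + norm z)"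
  have R: "R > 1" "R * norm z < 1" using z by (auto simp: R_def field_simps add_pos_nonneg)
  have in_ball: "\<tau> *s z \<in> unit_ball" if "\<tau> \<in> ball 0 R" for \<tau>
  proof -
    have "norm (\<tau> *s z) \<le> R * norm z"
      unfolding norm_vector_scale using that by (intro mult_right_mono) auto
    then show ?thesis using R by simp
  qed
  have "f (1 *s z) $ j - p (1 *s z) = 0"
  proof (rule holomorphic_zero_of_zero_near_real[where S = "ball 0 R" and \<epsilon> = \<epsilon>
        and \<phi> = "\<lambda>\<tau>. f (\<tau> *s z) $ j - p (\<tau> *s z)" and \<zeta> = 1])
    show "(\<lambda>\<tau>. f (\<tau> *s z) $ j - p (\<tau> *s z)) holomorphic_on ball 0 R"
      using in_ball by (intro holomorphic_on_diff polynomial_fun_line_holomorphic[OF p]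
          holomorphic_map_on_components[OF f]) (auto intro!: holomorphic_intros)
  qed (use R \<open>\<epsilon> > 0\<close> eq in auto)
  then show ?thesis by simp
qed

text \<open>
  The automorphism \<open>\<psi>\<close> with \<open>f \<circ> U = \<psi> \<circ> f\<close> fixes the origin because \<open>f\<close> does, so \<open>f \<circ> U\<close> and \<open>f\<close>
  have equal norms and polarization applies.
\<close>
lemma Gamma_unitary_cip:
  assumes f: "holomorphic_map_on f unit_ball" "f ` unit_ball \<subseteq> unit_ball" "f 0 = 0"
    and U: "U \<in> Gamma_unitary f"
    and "z \<in> unit_ball" "w \<in> unit_ball"
  shows "cip (f (U *v z)) (f (U *v w)) = cip (f z) (f w)"
proof -
  have "(\<lambda>z. U *v z) \<in> Gamma_group f" using U by (simp add: Gamma_unitary_def)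
  then obtain \<psi> where \<psi>: "\<psi> \<in> Aut_ball" "\<And>z. z \<in> unit_ball \<Longrightarrow> f (U *v z) = \<psi> (f z)"
    and U'': "(\<lambda>z. U *v z) \<in> Aut_ball"
    unfolding Gamma_group_def by blast
  have U': "(\<lambda>z. U *v z) ` unit_ball \<subseteq> unit_ball" using U'' by (simp add: Aut_ball_def)
  have "\<psi> 0 = 0" using \<psi>(2)[of 0] f(3) by simp
  have "norm (f (U *v z)) = norm (f z)" if "z \<in> unit_ball" for z
    unfolding \<psi>(2)[OF that] using f(2) that by (intro Aut_ball_fixing_0_norm[OF \<psi>(1) \<open>\<psi> 0 = 0\<close>]) blast
  moreover have "holomorphic_map_on (\<lambda>z. f (U *v z)) unit_ball"
    unfolding holomorphic_map_on_def
  proof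
    fix z :: "complex ^ 'a" assume "z \<in> unit_ball"
    then obtain D where D: "Vector_Spaces.linear (*s) (*s) D" "(f has_derivative D) (at (U *v z))"
      using f(1) U' unfolding holomorphic_map_on_def by blast
    have "((*v) U has_derivative (*v) U) (at z)"
      by (intro bounded_linear_imp_has_derivative linear_conv_bounded_linear[THEN iffD1]) auto
    from has_derivative_compose[OF this D(2)]
    have "((\<lambda>z. f (U *v z)) has_derivative (\<lambda>x. D (U *v x))) (at z)" .
    moreover have "Vector_Spaces.linear (*s) (*s) (\<lambda>x. D (U *v x))"
      using Vector_Spaces.linear_compose[OF matrix_vector_mul_linear_gen D(1)] by (simp add: o_def)
    ultimately show "\<exists>D. Vector_Spaces.linear (*s) (*s) D \<and> ((\<lambda>z. f (U *v z)) has_derivative D) (at z)"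
      by blast
  qed
  ultimately show ?thesis using f(1) assms(5,6) by (intro cip_eq_of_norm_eq)
qed

lemma matrix_exp_diag_flow:
  assumes "\<And>i. M *v column i P = (\<i> * of_real (d i)) *s column i P"
  shows "matrix_exp (t *\<^sub>R M) *v (P *v x) = P *v diag_flow d (of_real t) x"
proof -
  have "(t *\<^sub>R M) *v column i P = (\<i> * of_real t * of_real (d i)) *s column i P" for i
  proof -
    have "(t *\<^sub>R M) *v column i P = t *\<^sub>R (M *v column i P)"
      by (simp add: vec_eq_iff matrix_vector_mult_def scaleR_sum_right)
    then show ?thesis by (simp add: assms scaleR_vec_eq_scale vector_smult_assoc mult_ac)
  qed
  then have col: "matrix_exp (t *\<^sub>R M) *v column i P = exp (\<i> * of_real t * of_real (d i)) *s column i P" for i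
    by (rule matrix_exp_eigenvector)
  have "matrix_exp (t *\<^sub>R M) *v (P *v x) = (\<Sum>i\<in>UNIV. x $ i *s (matrix_exp (t *\<^sub>R M) *v column i P))"
    by (simp add: matrix_mult_sum[of P x] vec.linear_sum[OF matrix_vector_mul_linear_gen] vector_scalar_commute)
  also have "\<dots> = P *v diag_flow d (of_real t) x"
    by (simp add: col matrix_mult_sum[of P "diag_flow _ _ _"] diag_flow_nth vector_smult_assoc mult.commute)
  finally show ?thesis .
qed

theorem theorem1p1:
  fixes f :: "complex ^ 'n \<Rightarrow> complex ^ 'm"
    and M L :: "complex ^ 'n ^ 'n"
    and k :: nat
  assumes "holomorphic_map_on f unit_ball"
    and "f ` unit_ball \<subseteq> unit_ball"
    and "f 0 = 0"
    and "M \<in> Gamma_lie_algebra f"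
    and "L = map_matrix (\<lambda>c. - \<i> * c) M"
    and "num_pos_eigenvalues L = k"
  shows "\<exists>V. vec.subspace V \<and> vec.dim V = k \<and> polynomial_map_on f (V \<inter> unit_ball)"
proof -
  have L: "L $ i $ j = - \<i> * M $ i $ j" for i j
    by (simp add: assms(5) map_matrix_def)
  have M: "M $ i $ j = - cnj (M $ j $ i)" for i j
    using assms(4) by (simp add: Gamma_lie_algebra_def skew_hermitian_def conj_transpose_def
        map_matrix_def transpose_def vec_eq_iff)
  have "cnj (L $ j $ i) = L $ i $ j" for i j
    unfolding L by (subst M[of i j]) simp
  then have "conj_transpose L = L"
    by (simp add: conj_transpose_def map_matrix_def transpose_def vec_eq_iff)
  from hermitian_diagonalization[OF this]
  obtain P Q and d :: "'n \<Rightarrow> real" where PQ: "P ** Q = mat 1" "Q ** P = mat 1"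
    and eig: "\<And>i. L *v column i P = of_real (d i) *s column i P"
    by blast
  define J where "J = {i. d i > 0}"
  define C where "C = {x :: complex ^ 'n. \<forall>i. i \<notin> J \<longrightarrow> x $ i = 0}"
  define V where "V = (*v) P ` C"
  have k: "k = card J"
    using num_pos_eigenvalues_diagonalizable[OF PQ eig] assms(6) by (simp add: J_def)
  have QP: "Q *v (P *v x) = x" for x by (simp add: matrix_vector_mul_assoc PQ)
  have "vec.subspace C" by (auto simp: C_def vec.subspace_def)
  then have "vec.subspace V"
    unfolding V_def by (intro vec.linear_subspace_image matrix_vector_mul_linear_gen)
  moreover have "vec.dim V = k"
  proof -
    have "inj_on ((*v) P) (vec.span C)" using QP by (metis inj_onI)
    then have "vec.dim V = vec.dim C"
      unfolding V_def by (intro vec.dim_image_eq matrix_vector_mul_linear_gen)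
    then show ?thesis by (simp add: k C_def dim_substandard_cart)
  qed
  moreover have "polynomial_map_on f (V \<inter> unit_ball)"
    unfolding polynomial_map_on_def
  proof
    fix j
    \<comment> \<open>Chosen so that the polydisc of radius \<open>r\<close> in eigencoordinates is mapped into the unit ball.\<close>
    define r where "r = 1 / (1 + (\<Sum>i\<in>UNIV. norm (column i P)))"
    have "r > 0" by (simp add: r_def add_pos_nonneg sum_nonneg)
    have P_ball: "P *v x \<in> unit_ball" if "x \<in> polydisc J r" for x
    proof -
      have "norm (P *v x) \<le> (\<Sum>i\<in>UNIV. norm (x $ i) * norm (column i P))"
        unfolding matrix_mult_sum by (intro order_trans[OF norm_sum]) (simp add: norm_vector_scale)
      also have "\<dots> \<le> (\<Sum>i\<in>UNIV. r * norm (column i P))"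
        using that by (intro sum_mono mult_right_mono) (auto simp: polydisc_def less_imp_le)
      also have "\<dots> = r * (\<Sum>i\<in>UNIV. norm (column i P))" by (simp add: sum_distrib_left)
      also have "\<dots> < 1" unfolding r_def
        by (simp add: divide_less_eq add_pos_nonneg sum_nonneg)
      finally show ?thesis by simp
    qed
    have M_eig: "M *v column i P = (\<i> * of_real (d i)) *s column i P" for i
    proof -
      have "M *v column i P = \<i> *s (L *v column i P)"
        by (simp add: vec_eq_iff matrix_vector_mult_def L sum_distrib_left flip: mult.assoc)
      then show ?thesis by (simp add: eig vector_smult_assoc)
    qed
    have "cip (f (P *v diag_flow d (of_real t) x)) (f (P *v diag_flow d (of_real t) y))
        = cip (f (P *v x)) (f (P *v y))"
      if "x \<in> polydisc J r" "y \<in> polydisc J r" for t x y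
      using Gamma_unitary_cip[OF assms(1-3) _ P_ball[OF that(1)] P_ball[OF that(2)], of "matrix_exp (t *\<^sub>R M)"]
        assms(4) by (simp add: Gamma_lie_algebra_def matrix_exp_diag_flow[OF M_eig])
    then obtain p where p: "polynomial_fun p" "\<And>x. x \<in> polydisc J r \<Longrightarrow> f (P *v x) $ j = p x"
      using polynomial_on_polydisc[OF assms(1,2) _ \<open>r > 0\<close> P_ball, where d = d and J = J] 
      unfolding J_def by blast
    have pQ: "polynomial_fun (\<lambda>z. p (Q *v z))"
      by (intro polynomial_fun_compose[OF p(1)])
         (simp add: matrix_vector_mult_def polynomial_fun_intros)
    have "f z $ j = p (Q *v z)" if z: "z \<in> V \<inter> unit_ball" for z
    proof -
      obtain x where x: "x \<in> C" "z = P *v x" using z by (auto simp: V_def)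
      define \<epsilon> where "\<epsilon> = r / (1 + norm x)"
      have "\<epsilon> > 0" using \<open>r > 0\<close> by (simp add: \<epsilon>_def add_pos_nonneg)
      show ?thesis
      proof (rule polynomial_on_ball_of_polydisc[OF assms(1) pQ _ \<open>\<epsilon> > 0\<close>])
        fix t :: real assume t: "\<bar>t\<bar> < \<epsilon>"
        have "norm (complex_of_real t * x $ i) < r" for i
        proof -
          have "norm (complex_of_real t * x $ i) \<le> \<bar>t\<bar> * (1 + norm x)"
            unfolding norm_mult norm_of_real
            using Finite_Cartesian_Product.norm_nth_le[of x i] by (intro mult_left_mono) (auto intro: order_trans)
          also have "\<dots> < r" using t by (simp add: \<epsilon>_def less_divide_eq add_pos_nonneg)
          finally show ?thesis .
        qed
        then have "of_real t *s x \<in> polydisc J r" using x(1) by (simp add: polydisc_def C_def)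
        from p(2)[OF this] show "f (of_real t *s z) $ j = p (Q *v (of_real t *s z))"
          by (simp add: x(2) QP flip: vector_scalar_commute)
      qed (use z in auto)
    qed
    with pQ show "\<exists>p. polynomial_fun p \<and> (\<forall>z\<in>V \<inter> unit_ball. f z $ j = p z)" by blast
  qed
  ultimately show ?thesis by blast
qed

end
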